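(* Let $\mathcal{O}\subset\mathbb{R}^d$ be a nonempty bounded open set. If $x\in X$ is heavy (for $a_t$ in positive time), then $\dim_H F_{S^+(\mathcal{O})}(x)<d$. In fact, for any given sequence of non-negative numbers $\eta_i\to 0$ there exists $\delta=\delta(\mathcal{O},(\eta_i))>0$ such that for every $x\in\mathcal{H}(\eta_i)$, $$\dim_H F_{S^+(\mathcal{O})}(x)<d-\delta.$$
   Context: Fix $d\ge 2$ and $a_t=\mathrm{diag}(e^{c_1t},\dots,e^{c_dt})$, where $c_1,\dots,c_d$ are fixed non-zero real numbers with $\sum_j c_j=0$. For a bounded open $\mathcal{O}\subset\mathbb{R}^d$, its positive spike is $S^+(\mathcal{O})=\bigcup_{t>0}a_t^{-1}\mathcal{O}$. $X\simeq \mathrm{SL}_d(\mathbb{R})/\mathrm{SL}_d(\mathbb{Z})$ is the space of unimodular (covolume 1) lattices in $\mathbb{R}^d$. A unimodular grid is a coset $x+w$ with $x\in X$, $w\in\mathbb{R}^d$; $Y$ is the space of unimodular grids and $\pi:Y\to X$, $x+w\mapsto x$, the natural projection, so $\pi^{-1}(x)$ is the torus $\mathbb{R}^d/x$. Set $F_{S^+(\mathcal{O})}(x)=\{y\in\pi^{-1}(x): y\cap S^+(\mathcal{O})\text{ is finite}\}$. $\dim_H$ is Hausdorff dimension with respect to the Euclidean metric on $\pi^{-1}(x)\simeq\mathbb{R}^d/x$. Let $\mathscr{P}(X)$ be the space of Borel probability measures on $X$, viewed inside the dual of $C_0(X)$ with the weak* topology. For $x\in X$ and an integer $T\ge1$ let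 $\delta_x^T=\frac1T\sum_{i=0}^{T-1}\delta_{a_1^i x}$, where $\delta_z$ is the Dirac mass at $z$. Let $\{\delta_x^T\}^\omega$ denote the set of weak* accumulation points, i.e. limits of $\delta_x^{T_k}$ along sequences $T_k\to\infty$ (these are positive measures of total mass at most 1). The lattice $x$ is heavy if $\{\delta_x^T\}^\omega\cap\mathscr{P}(X)\neq\varnothing$. Fix once and for all functions $\psi_i\in C_c(X)$ with $0\le\psi_i\le1$ such that $\psi_i^{-1}(1)$ is an increasing sequence of compact sets covering $X$. For a sequence of non-negative numbers $\eta_i\to0$ put $\mathscr{P}(X,(\eta_i))=\{\mu\in\mathscr{P}(X):\forall i,\ \int\psi_i\,d\mu\ge1-\eta_i\}$ and $\mathcal{H}(\eta_i)=\{x\in X:\{\delta_x^T\}^\omega\cap\mathscr{P}(X,(\eta_i))\ne\varnothing\}$. *)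

theory Defs
  imports "HOL-Probability.Probability"
begin

definition integer_vectors :: "(real ^ 'n) set" where
  "integer_vectors = {z. \<forall>i. z $ i \<in> \<int>}"

definition SL :: "(real ^ 'n ^ 'n) set" where
  "SL = {g. det g = 1}"

text \<open>
  A lattice of covolume 1 has a basis matrix of determinant 1 or -1, and a sign change of one basis
  vector makes it 1. The type below is therefore the set of all unimodular lattices, with the
  topology of the quotient of \<open>SL\<close> by the stabiliser of the integer vectors.
\<close>

typedef ('n::finite) ulattice = "{(*v) g ` integer_vectors |g. g \<in> (SL :: (real ^ 'n ^ 'n) set)}"
  morphisms lattice_points Abs_ulattice
proof -
  have "mat 1 \<in> (SL :: (real ^ 'n ^ 'n) set)"
    by (simp add: SL_def)
  then show ?thesis by blast
qed

setup_lifting type_definition_ulattice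

definition lattice_of :: "real ^ 'n ^ 'n \<Rightarrow> 'n::finite ulattice" where
  "lattice_of g = Abs_ulattice ((*v) g ` integer_vectors)"

instantiation ulattice :: (finite) topological_space
begin

definition open_ulattice :: "'a ulattice set \<Rightarrow> bool" where
  "open_ulattice U \<longleftrightarrow> openin (top_of_set SL) {g \<in> SL. lattice_of g \<in> U}"

instance
proof
  show "open (UNIV :: 'a ulattice set)"
    by (simp add: open_ulattice_def)
next
  fix S T :: "'a ulattice set"
  assume "open S" "open T"
  moreover have "{g \<in> SL. lattice_of g \<in> S \<inter> T}
      = {g \<in> SL. lattice_of g \<in> S} \<inter> {g \<in> SL. lattice_of g \<in> T}"
    by blast
  ultimately show "open (S \<inter> T)"
    unfolding open_ulattice_def by (simp only: openin_Int)
next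
  fix K :: "'a ulattice set set"
  assume "\<forall>S\<in>K. open S"
  then have "openin (top_of_set SL) (\<Union>S\<in>K. {g \<in> SL. lattice_of g \<in> S})"
    unfolding open_ulattice_def by (intro openin_Union) blast
  moreover have "{g \<in> SL. lattice_of g \<in> \<Union>K} = (\<Union>S\<in>K. {g \<in> SL. lattice_of g \<in> S})"
    by blast
  ultimately show "open (\<Union>K)"
    unfolding open_ulattice_def by (simp only:)
qed

end

text \<open>Outside \<open>SL\<close> the action is the identity, a junk value.\<close>

lift_definition act :: "real ^ 'n ^ 'n \<Rightarrow> 'n::finite ulattice \<Rightarrow> 'n ulattice" is
  "\<lambda>g L. if g \<in> SL then (*v) g ` L else L"
proof goal_cases
  case (1 g L)
  then obtain h where h: "h \<in> SL" "L = (*v) h ` integer_vectors"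
    by blast
  have "g ** h \<in> SL" if "g \<in> SL"
    using that h(1) by (simp add: SL_def det_mul)
  moreover have "(*v) g ` L = (*v) (g ** h) ` integer_vectors"
    unfolding h(2) by (simp add: image_image matrix_vector_mul_assoc)
  ultimately show ?case
    using h by auto
qed

definition grids :: "(real ^ 'n) set set" where
  "grids = {(+) w ` lattice_points x |x w. True}"

definition grid_proj :: "(real ^ 'n) set \<Rightarrow> 'n::finite ulattice" where
  "grid_proj y = (THE x. \<exists>w. y = (+) w ` lattice_points x)"

definition grid_fibre :: "'n::finite ulattice \<Rightarrow> (real ^ 'n) set set" where
  "grid_fibre x = {y \<in> grids. grid_proj y = x}"

lemma lattice_points_eq:
  obtains g where "g \<in> SL" "lattice_points (x :: 'n::finite ulattice) = (*v) g ` integer_vectors"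
  using lattice_points[of x] by blast

lemma diff_lattice_points:
  assumes "p \<in> lattice_points (x :: 'n::finite ulattice)" "q \<in> lattice_points x"
  shows "p - q \<in> lattice_points x"
proof -
  obtain g :: "real ^ 'n ^ 'n" where g: "lattice_points x = (*v) g ` integer_vectors"
    using lattice_points_eq by blast
  obtain a b where "a \<in> integer_vectors" "b \<in> integer_vectors" "p = g *v a" "q = g *v b"
    using assms unfolding g by blast
  moreover from this have "a - b \<in> integer_vectors"
    by (simp add: integer_vectors_def)
  ultimately show ?thesis
    unfolding g by (metis image_eqI matrix_vector_mult_diff_distrib)
qed

lemma zero_lattice_points: "0 \<in> lattice_points (x :: 'n::finite ulattice)"
proof -
  obtain g :: "real ^ 'n ^ 'n" where g: "lattice_points x = (*v) g ` integer_vectors"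
    using lattice_points_eq by blast
  have "(0 :: real ^ 'n) \<in> integer_vectors"
    by (simp add: integer_vectors_def)
  then show ?thesis
    unfolding g by (metis image_eqI matrix_vector_mult_0_right)
qed

lemma minus_lattice_points:
  "p \<in> lattice_points (x :: 'n::finite ulattice) \<Longrightarrow> - p \<in> lattice_points x"
  using diff_lattice_points[OF zero_lattice_points] by force

lemma closed_lattice_points: "closed (lattice_points (x :: 'n::finite ulattice))"
proof -
  obtain g where g: "g \<in> SL" "lattice_points x = (*v) g ` integer_vectors"
    by (rule lattice_points_eq)
  have "inj ((*v) g)"
    using g(1) by (metis SL_def invertible_det_nz inj_matrix_vector_mult mem_Collect_eq zero_neq_one)
  moreover have "closed (integer_vectors :: (real ^ 'n) set)"
  proof -
    have "integer_vectors = (\<Inter>i. (\<lambda>z :: real ^ 'n. z $ i) -` \<int>)"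
      by (auto simp: integer_vectors_def)
    moreover have "closed (\<Inter>i. (\<lambda>z :: real ^ 'n. z $ i) -` \<int>)"
      by (intro closed_INT ballI closed_vimage closed_Ints continuous_intros)
    ultimately show ?thesis by simp
  qed
  ultimately show ?thesis
    unfolding g(2) by (intro closed_injective_linear_image) auto
qed

lemma coset_eq_imp_lattice_eq:
  assumes "(+) w ` lattice_points (x :: 'n::finite ulattice) = (+) w' ` lattice_points x'"
  shows "x = x'"
proof -
  have *: "lattice_points z = {p - q |p q. p \<in> (+) v ` lattice_points z \<and> q \<in> (+) v ` lattice_points z}"
    for z :: "'n ulattice" and v
  proof (intro set_eqI iffI)
    fix p assume p: "p \<in> lattice_points z"
    have "p = (v + p) - (v + 0)" by simp
    then show "p \<in> {p - q |p q. p \<in> (+) v ` lattice_points z \<and> q \<in> (+) v ` lattice_points z}"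
      using p zero_lattice_points[of z] by blast
  qed (auto intro: diff_lattice_points)
  show ?thesis
    using *[of x w] *[of x' w'] assms by (metis lattice_points_inject)
qed

lemma grid_proj_coset: "grid_proj ((+) w ` lattice_points x) = x"
  unfolding grid_proj_def by (rule the_equality) (auto dest: coset_eq_imp_lattice_eq)

lemma grid_fibre_eq: "grid_fibre x = range (\<lambda>w. (+) w ` lattice_points x)"
  by (auto simp: grid_fibre_def grids_def grid_proj_coset)

text \<open>
  The quotient metric that the torus inherits from Euclidean space is the distance
  of cosets as sets.
\<close>

lemma setdist_cosets:
  "setdist ((+) w ` lattice_points x) ((+) w' ` lattice_points x)
    = setdist {w - w'} (lattice_points (x :: 'n::finite ulattice))" (is "?l = ?r")
proof -
  have ne: "lattice_points x \<noteq> {}"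
    using zero_lattice_points by blast
  show ?thesis
  proof (rule antisym)
    show "?l \<le> ?r"
    proof (rule le_setdistI)
      fix a b assume "a \<in> {w - w'}" and b: "b \<in> lattice_points x"
      then have "a - b = (w + 0) - (w' + b)"
        by simp
      then have "dist a b = dist (w + 0) (w' + b)"
        by (simp only: dist_norm)
      also have "\<dots> \<ge> ?l"
        using b zero_lattice_points[of x] by (intro setdist_le_dist) blast+
      finally show "?l \<le> dist a b" .
    qed (use ne in auto)
    show "?r \<le> ?l"
    proof (rule le_setdistI)
      fix a b
      assume "a \<in> (+) w ` lattice_points x" "b \<in> (+) w' ` lattice_points x"
      then obtain p q where pq: "p \<in> lattice_points x" "q \<in> lattice_points x" "a = w + p" "b = w' + q"
        by blast
      have "a - b = (w - w') - (q - p)"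
        using pq by simp
      then have "dist a b = dist (w - w') (q - p)"
        by (simp only: dist_norm)
      also have "\<dots> \<ge> ?r"
        using pq by (intro setdist_le_dist diff_lattice_points) auto
      finally show "?r \<le> dist a b" .
    qed (use ne in auto)
  qed
qed

lemma Metric_space_grid_fibre: "Metric_space (grid_fibre (x :: 'n::finite ulattice)) setdist"
proof
  fix y y' assume "y \<in> grid_fibre x" "y' \<in> grid_fibre x"
  then obtain w w' where w: "y = (+) w ` lattice_points x" "y' = (+) w' ` lattice_points x"
    by (auto simp: grid_fibre_eq)
  have "setdist y y' = 0 \<longleftrightarrow> w - w' \<in> lattice_points x"
    unfolding w setdist_cosets setdist_eq_0_sing_1 closure_closed[OF closed_lattice_points]
    using zero_lattice_points[of x] by blast
  also have "\<dots> \<longleftrightarrow> y = y'"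
  proof
    assume *: "w - w' \<in> lattice_points x"
    have "w + p \<in> y'" if "p \<in> lattice_points x" for p
    proof -
      have "(w - w') - (- p) \<in> lattice_points x"
        using that by (intro diff_lattice_points[OF *] minus_lattice_points)
      moreover have "w + p = w' + ((w - w') - (- p))" by simp
      ultimately show ?thesis unfolding w by (rule rev_image_eqI)
    qed
    moreover have "w' + p \<in> y" if "p \<in> lattice_points x" for p
    proof -
      have "p - (w - w') \<in> lattice_points x"
        by (rule diff_lattice_points[OF that *])
      moreover have "w' + p = w + (p - (w - w'))" by simp
      ultimately show ?thesis unfolding w by (rule rev_image_eqI)
    qed
    ultimately show "y = y'"
      unfolding w by (intro equalityI image_subsetI) blast+
  next
    assume "y = y'"
    then have "w + 0 \<in> (+) w' ` lattice_points x"
      using zero_lattice_points[of x] unfolding w by blast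
    then obtain q where "q \<in> lattice_points x" "w + 0 = w' + q" by blast
    then show "w - w' \<in> lattice_points x" by (simp add: diff_eq_eq add.commute)
  qed
  finally show "setdist y y' = 0 \<longleftrightarrow> y = y'" .
next
  fix y y' y''
  assume "y \<in> grid_fibre x" "y' \<in> grid_fibre x" "y'' \<in> grid_fibre x"
  then obtain w w' w'' where w: "y = (+) w ` lattice_points x" "y' = (+) w' ` lattice_points x"
    "y'' = (+) w'' ` lattice_points x"
    by (auto simp: grid_fibre_eq)
  have ne: "lattice_points x \<noteq> {}"
    using zero_lattice_points by blast
  have *: "setdist y y'' \<le> dist (w - w') p + dist (w' - w'') q"
    if "p \<in> lattice_points x" "q \<in> lattice_points x" for p q
  proof -
    have "p - (- q) \<in> lattice_points x"
      using that by (intro diff_lattice_points minus_lattice_points)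
    then have "setdist {w - w''} (lattice_points x) \<le> dist (w - w'') (p - (- q))"
      by (intro setdist_le_dist) auto
    also have "\<dots> = norm ((w - w' - p) + (w' - w'' - q))"
      by (simp add: dist_norm algebra_simps)
    also have "\<dots> \<le> dist (w - w') p + dist (w' - w'') q"
      unfolding dist_norm by (rule norm_triangle_ineq)
    finally show ?thesis unfolding w setdist_cosets .
  qed
  have "setdist y y'' - dist (w - w') p \<le> setdist {w' - w''} (lattice_points x)"
    if "p \<in> lattice_points x" for p
    using *[OF that] ne by (intro le_setdistI) (auto simp: algebra_simps)
  then have "setdist y y'' - setdist {w' - w''} (lattice_points x) \<le> setdist {w - w'} (lattice_points x)"
    using ne by (intro le_setdistI) (auto simp: algebra_simps)
  then show "setdist y y'' \<le> setdist y y' + setdist y' y''"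
    unfolding w setdist_cosets by simp
qed (simp_all add: setdist_pos_le setdist_sym)

context Metric_space
begin

definition diam :: "'a set \<Rightarrow> real" where
  "diam U = (if U = {} then 0 else (SUP (x, y)\<in>U \<times> U. d x y))"

definition hausdorff_premeasure :: "real \<Rightarrow> real \<Rightarrow> 'a set \<Rightarrow> ennreal" where
  "hausdorff_premeasure s \<epsilon> A =
    (INF U \<in> {U :: nat \<Rightarrow> 'a set. A \<subseteq> (\<Union>i. U i) \<and>
        (\<forall>i. U i \<subseteq> M \<and> (\<forall>x\<in>U i. \<forall>y\<in>U i. d x y \<le> \<epsilon>))}.
      \<Sum>i. ennreal (diam (U i) powr s))"

definition hausdorff_measure :: "real \<Rightarrow> 'a set \<Rightarrow> ennreal" where
  "hausdorff_measure s A = (SUP \<epsilon>\<in>{0<..}. hausdorff_premeasure s \<epsilon> A)"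

text \<open>
  Only positive \<open>s\<close> are admitted because \<open>0 powr 0 = 0\<close>, so that \<open>hausdorff_measure 0\<close>
  is not the counting measure. This does not affect the infimum; the empty set has dimension 0.
\<close>

definition hausdorff_dim :: "'a set \<Rightarrow> ereal" where
  "hausdorff_dim A = (INF s \<in> {s. 0 < s \<and> hausdorff_measure s A = 0}. ereal s)"

end

definition torus_hausdorff_dim :: "'n::finite ulattice \<Rightarrow> (real ^ 'n) set set \<Rightarrow> ereal" where
  "torus_hausdorff_dim x = Metric_space.hausdorff_dim (grid_fibre x) setdist"

definition diag_flow :: "real ^ 'n \<Rightarrow> real \<Rightarrow> real ^ 'n ^ 'n" where
  "diag_flow c t = (\<chi> i j. if i = j then exp (c $ i * t) else 0)"

lemma diag_flow_in_SL:
  fixes c :: "real ^ 'n"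
  assumes "(\<Sum>j\<in>UNIV. c $ j) = 0"
  shows "diag_flow c t \<in> SL"
proof -
  have "det (diag_flow c t) = (\<Prod>j\<in>UNIV. exp (c $ j * t))"
    by (subst det_diagonal) (simp_all add: diag_flow_def)
  also have "\<dots> = exp ((\<Sum>j\<in>UNIV. c $ j) * t)"
    by (simp add: exp_sum sum_distrib_right)
  finally show ?thesis
    using assms by (simp add: SL_def)
qed

definition positive_spike :: "real ^ 'n \<Rightarrow> (real ^ 'n) set \<Rightarrow> (real ^ 'n) set" where
  "positive_spike c \<O> = (\<Union>t\<in>{0<..}. (*v) (matrix_inv (diag_flow c t)) ` \<O>)"

definition finite_grids :: "(real ^ 'n) set \<Rightarrow> 'n::finite ulattice \<Rightarrow> (real ^ 'n) set set" where
  "finite_grids S x = {y \<in> grid_fibre x. finite (y \<inter> S)}"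

definition C0_functions :: "('a::topological_space \<Rightarrow> real) set" where
  "C0_functions = {f. continuous_on UNIV f \<and> (\<forall>\<epsilon>>0. \<exists>K. compact K \<and> (\<forall>z. z \<notin> K \<longrightarrow> \<bar>f z\<bar> < \<epsilon>))}"

definition Cc_functions :: "('a::topological_space \<Rightarrow> real) set" where
  "Cc_functions = {f. continuous_on UNIV f \<and> compact (closure {z. f z \<noteq> 0})}"

definition empirical_measure :: "real ^ 'n \<Rightarrow> nat \<Rightarrow> 'n::finite ulattice \<Rightarrow> 'n ulattice measure" where
  "empirical_measure c T x =
    distr (uniform_count_measure {..<T}) borel (\<lambda>i. (act (diag_flow c 1) ^^ i) x)"

lemma emeasure_empirical_measure:
  assumes "T \<ge> 1" "A \<in> sets borel"
  shows "emeasure (empirical_measure c T x) A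
    = ennreal ((\<Sum>i<T. indicator A ((act (diag_flow c 1) ^^ i) x)) / real T)"
proof -
  let ?B = "{i \<in> {..<T}. (act (diag_flow c 1) ^^ i) x \<in> A}"
  have "emeasure (empirical_measure c T x) A = emeasure (uniform_count_measure {..<T}) ?B"
    unfolding empirical_measure_def using assms(2)
    by (subst emeasure_distr)
      (auto simp: measurable_def sets_uniform_count_measure space_uniform_count_measure
        intro!: arg_cong2[where f = emeasure])
  also have "\<dots> = ennreal (real (card ?B) / real T)"
    by (subst emeasure_uniform_count_measure) auto
  also have "real (card ?B) = (\<Sum>i<T. indicator A ((act (diag_flow c 1) ^^ i) x))"
    by (simp add: indicator_def sum.If_cases Int_def conj_commute)
  finally show ?thesis .
qed

definition weak_star_limit :: "(nat \<Rightarrow> 'a::topological_space measure) \<Rightarrow> 'a measure \<Rightarrow> bool" where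
  "weak_star_limit \<nu> \<mu> \<longleftrightarrow>
    (\<forall>f\<in>C0_functions. (\<lambda>k. \<integral>z. f z \<partial>\<nu> k) \<longlonglongrightarrow> (\<integral>z. f z \<partial>\<mu>))"

text \<open>
  By Riesz representation the accumulation points in the dual of \<open>C0_functions\<close> are given by
  Borel measures of total mass at most 1.
\<close>

definition accumulation_measures :: "real ^ 'n \<Rightarrow> 'n::finite ulattice \<Rightarrow> 'n ulattice measure set" where
  "accumulation_measures c x = {\<mu>. sets \<mu> = sets borel \<and> emeasure \<mu> UNIV \<le> 1 \<and>
    (\<exists>T :: nat \<Rightarrow> nat. (\<forall>k. T k \<ge> 1) \<and> filterlim T at_top sequentially \<and>
      weak_star_limit (\<lambda>k. empirical_measure c (T k) x) \<mu>)}"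

definition borel_prob_measures :: "'a::topological_space measure set" where
  "borel_prob_measures = {\<mu>. sets \<mu> = sets borel \<and> prob_space \<mu>}"

definition heavy :: "real ^ 'n \<Rightarrow> 'n::finite ulattice \<Rightarrow> bool" where
  "heavy c x \<longleftrightarrow> accumulation_measures c x \<inter> borel_prob_measures \<noteq> {}"

definition tight_prob_measures ::
  "(nat \<Rightarrow> 'a::topological_space \<Rightarrow> real) \<Rightarrow> (nat \<Rightarrow> real) \<Rightarrow> 'a measure set" where
  "tight_prob_measures \<psi> \<eta> = {\<mu> \<in> borel_prob_measures. \<forall>i. (\<integral>z. \<psi> i z \<partial>\<mu>) \<ge> 1 - \<eta> i}"

definition heavy_lattices ::
  "real ^ 'n \<Rightarrow> (nat \<Rightarrow> 'n::finite ulattice \<Rightarrow> real) \<Rightarrow> (nat \<Rightarrow> real) \<Rightarrow> 'n ulattice set" where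
  "heavy_lattices c \<psi> \<eta> = {x. accumulation_measures c x \<inter> tight_prob_measures \<psi> \<eta> \<noteq> {}}"

end

theory Submission
  imports Defs
begin

text \<open>
  A grid is \<open>x + w\<close>. After replacing \<open>\<O>\<close> by a small cube inside it that stays away from the
  origin, the grid has finitely many points in the spike only if from some integer time on no
  point of \<open>a\<^sub>n (x + w)\<close> lies in that cube \<open>H\<close>; the reason is that no single orbit
  \<open>a\<^sub>n p\<close> can return to \<open>H\<close> at arbitrarily late times, all \<open>c\<^sub>i\<close> being nonzero. So the
  translation vector \<open>w\<close> has to avoid the hole \<open>a\<^sub>n\<^sup>-\<^sup>1 H + x\<close> for all large \<open>n\<close>.

  The idea is that holes met at times when the orbit of \<open>x\<close> is in a compact set remove a fixed
  proportion of the remaining vectors \<open>w\<close>. Lattices in a compact set have a common covering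
  radius \<open>\<rho>\<close> (lemma \<open>compact_covering_radius\<close>). If \<open>a\<^sub>s x\<close> is such a lattice, then every cube
  of size about \<open>\<rho>\<close> contains, modulo \<open>a\<^sub>s x\<close>, the point \<open>a\<^sub>L\<^sup>-\<^sup>1 q\<close>, where \<open>q\<close> is the
  centre of \<open>H\<close>. Moving that point by at most \<open>\<rho>\<close> along the contracted coordinates changes
  its image under \<open>a\<^sub>L\<close> by at most \<open>\<rho> e\<^bsup>-\<beta>L\<^esup>\<close>, which is below the size of \<open>H\<close> once the
  constant \<open>L\<close> is large. Hence every box that is long in the expanded directions and
  arbitrarily thin in the contracted ones meets the hole at time \<open>s + L\<close>, and even contains
  a subbox of comparable volume inside that hole (lemma \<open>ex_subcell_in_hole\<close>).

  The boxes are dyadic: side \<open>2\<^sup>-\<^sup>k\<close> with \<open>2\<^sup>k\<close> close to \<open>e\<^bsup>c\<^sub>i t\<^esup>\<close> in an expanded direction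
  and side 1 in a contracted one, so that the boxes of a later time subdivide exactly those of
  an earlier time. Time is cut into blocks of length \<open>4L\<close>, and a block is good if the orbit of
  \<open>x\<close> visits the compact set in the second quarter of the block. In a good block each box
  loses at least one of its at most \<open>2\<^sup>D\<close> subboxes, so the proportion of boxes that are needed
  drops by the factor \<open>1 - 2\<^sup>-\<^sup>D\<close>. If along a sequence of times \<open>T\<close> at least 7/8 of the times are
  visits, then at least about half of the blocks are good (lemma \<open>card_good_blocks\<close>). Cutting
  the boxes into cubes gives covers with exponentially fewer cubes than the full count, hence a
  drop of the dimension that depends only on the compact set, on \<open>\<O>\<close> and on \<open>c\<close>
  (lemma \<open>uniform_dimension_drop\<close>).

  The frequency of visits is where the limit measure enters: testing the weak* convergence
  against one \<open>\<psi>\<^sub>i\<close> with \<open>\<eta>\<^sub>i < 1/8\<close> shows that the support of \<open>\<psi>\<^sub>i\<close> is visited often enough.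
  For a single heavy lattice the masses \<open>1 - \<integral>\<psi>\<^sub>i\<close> of its own limit measure serve as \<open>\<eta>\<^sub>i\<close>.
\<close>

section \<open>Dyadic boxes\<close>

text \<open>
  The half-open dyadic boxes with side \<open>2\<^bsup>-k i\<^esup>\<close> in direction \<open>i\<close> partition the space; a box is
  represented by the integer vector of its lower corner, scaled by the sides. The least number of
  boxes that cover a set \<open>A\<close> is thus the cardinality of \<open>cell k ` A\<close>.
\<close>

definition cell :: "('n \<Rightarrow> nat) \<Rightarrow> real ^ 'n \<Rightarrow> 'n \<Rightarrow> int" where
  "cell k w = (\<lambda>i. \<lfloor>2 ^ k i * w $ i\<rfloor>)"

definition refine :: "('n \<Rightarrow> nat) \<Rightarrow> ('n \<Rightarrow> nat) \<Rightarrow> ('n \<Rightarrow> int) \<Rightarrow> 'n \<Rightarrow> int" where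
  "refine k k' z = (\<lambda>i. z i div 2 ^ (k' i - k i))"

lemma refine_cell:
  assumes "k \<le> k'"
  shows "refine k k' (cell k' w) = cell k w"
proof
  fix i
  have "k' i = k i + (k' i - k i)"
    using assms by (simp add: le_fun_def)
  then have "(2::real) ^ k' i = 2 ^ k i * 2 ^ (k' i - k i)"
    by (metis power_add)
  then have "2 ^ k i * w $ i = 2 ^ k' i * w $ i / real_of_int (2 ^ (k' i - k i))"
    by simp
  also have "\<lfloor>\<dots>\<rfloor> = \<lfloor>2 ^ k' i * w $ i\<rfloor> div 2 ^ (k' i - k i)"
    by (rule floor_divide_real_eq_div) simp
  finally show "refine k k' (cell k' w) i = cell k w i"
    by (simp add: refine_def cell_def)
qed

lemma card_refine_vimage:
  fixes k k' :: "'n::finite \<Rightarrow> nat"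
  shows "finite (refine k k' -` {z})" (is ?fin)
    and "card (refine k k' -` {z}) = 2 ^ (\<Sum>i\<in>UNIV. k' i - k i)" (is ?card)
proof -
  let ?B = "\<lambda>i. {z i * 2 ^ (k' i - k i) ..< (z i + 1) * 2 ^ (k' i - k i)}"
  have div_iff: "a div b = c \<longleftrightarrow> a \<in> {c * b ..< (c + 1) * b}" if "b > 0" for a b c :: int
  proof
    assume "a div b = c"
    then have "a = c * b + a mod b" by (metis div_mult_mod_eq)
    then show "a \<in> {c * b ..< (c + 1) * b}"
      using pos_mod_bound[OF that, of a] pos_mod_sign[OF that, of a] by (simp add: distrib_right)
  next
    assume "a \<in> {c * b ..< (c + 1) * b}"
    then have "a = (a - c * b) + c * b" "0 \<le> a - c * b" "a - c * b < b"
      by (auto simp: distrib_right)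
    then show "a div b = c"
      by (metis add.commute add_cancel_right_right div_mult_self1 div_pos_pos_trivial
          not_less_iff_gr_or_eq that)
  qed
  have eq: "refine k k' -` {z} = PiE UNIV ?B"
  proof (intro set_eqI)
    fix x :: "'n \<Rightarrow> int"
    have "x \<in> refine k k' -` {z} \<longleftrightarrow> (\<forall>i. x i div 2 ^ (k' i - k i) = z i)"
      by (simp add: refine_def fun_eq_iff)
    also have "\<dots> \<longleftrightarrow> (\<forall>i. x i \<in> ?B i)"
      by (subst div_iff) simp_all
    also have "\<dots> \<longleftrightarrow> x \<in> PiE UNIV ?B"
      by (simp add: PiE_iff)
    finally show "x \<in> refine k k' -` {z} \<longleftrightarrow> x \<in> PiE UNIV ?B" .
  qed
  show ?fin unfolding eq by (intro finite_PiE) auto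
  have "card (?B i) = 2 ^ (k' i - k i)" for i
    by (simp add: distrib_right nat_power_eq)
  then show ?card
    unfolding eq by (simp only: card_PiE finite_class.finite_UNIV power_sum)
qed

text \<open>
  Covering numbers under subdivision: if every box that meets \<open>A\<close> has \<open>h\<close> subboxes that miss
  \<open>A\<close>, these need not be counted. In the sequel \<open>h\<close> is 0 or 1.
\<close>

lemma card_cells_refine:
  fixes k k' :: "'n::finite \<Rightarrow> nat"
  assumes "k \<le> k'" and fin: "finite (cell k ` A)"
    and sub: "\<And>z. z \<in> cell k ` A \<Longrightarrow> h \<le> card (refine k k' -` {z} - cell k' ` A)"
  shows "finite (cell k' ` A)"
    and "card (cell k' ` A) \<le> card (cell k ` A) * (2 ^ (\<Sum>i\<in>UNIV. k' i - k i) - h)"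
proof -
  let ?F = "\<lambda>z. refine k k' -` {z} \<inter> cell k' ` A"
  have eq: "cell k' ` A = (\<Union>z\<in>cell k ` A. ?F z)"
    using refine_cell[OF assms(1)] by auto
  show "finite (cell k' ` A)"
    by (subst eq) (intro finite_UN_I fin finite_Int disjI1 card_refine_vimage)
  have "card (?F z) \<le> 2 ^ (\<Sum>i\<in>UNIV. k' i - k i) - h" if "z \<in> cell k ` A" for z
  proof -
    have "card (refine k k' -` {z}) = card (?F z) + card (refine k k' -` {z} - cell k' ` A)"
      by (metis card_Int_Diff card_refine_vimage(1))
    then show ?thesis
      using sub[OF that] card_refine_vimage(2)[of k k' z] by linarith
  qed
  then have "(\<Sum>z\<in>cell k ` A. card (?F z)) \<le> card (cell k ` A) * (2 ^ (\<Sum>i\<in>UNIV. k' i - k i) - h)"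
    using sum_bounded_above[of "cell k ` A" "\<lambda>z. card (?F z)"] by simp
  moreover have "card (cell k' ` A) \<le> (\<Sum>z\<in>cell k ` A. card (?F z))"
    using card_UN_le[OF fin, of ?F] eq by simp
  ultimately show "card (cell k' ` A) \<le> card (cell k ` A) * (2 ^ (\<Sum>i\<in>UNIV. k' i - k i) - h)"
    by linarith
qed

lemma finite_cells_bounded:
  fixes A :: "(real ^ 'n::finite) set"
  assumes "\<And>w i. w \<in> A \<Longrightarrow> \<bar>w $ i\<bar> \<le> R"
  shows "finite (cell k ` A)"
proof (rule finite_subset)
  let ?B = "\<lambda>i. {\<lfloor>- (2 ^ k i * R)\<rfloor> .. \<lfloor>2 ^ k i * R\<rfloor>}"
  show "cell k ` A \<subseteq> PiE UNIV ?B"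
  proof (intro image_subsetI)
    fix w assume "w \<in> A"
    then have "- (2 ^ k i * R) \<le> 2 ^ k i * w $ i \<and> 2 ^ k i * w $ i \<le> 2 ^ k i * R" for i
      using assms[of w i] mult_left_mono[of "- R" "w $ i" "2 ^ k i"] by (auto simp: abs_le_iff)
    then show "cell k w \<in> PiE UNIV ?B"
      by (auto simp: cell_def intro!: floor_mono)
  qed
qed (auto intro: finite_PiE)

lemma abs_diff_less_if_cell_eq:
  assumes "cell k w i = cell k w' i"
  shows "2 ^ k i * \<bar>w $ i - w' $ i\<bar> < 1"
proof -
  have "\<bar>2 ^ k i * w $ i - 2 ^ k i * w' $ i\<bar> < 1"
    using assms unfolding cell_def by linarith
  then show ?thesis
    by (simp add: abs_mult flip: right_diff_distrib)
qed

text \<open>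
  The boxes adapted to the flow at time \<open>t\<close>: expanded directions are cut to size about
  \<open>e\<^bsup>-c\<^sub>i t\<^esup>\<close>, which the flow blows up to size about 1, whereas contracted directions are
  never cut.
\<close>

definition level :: "real ^ 'n \<Rightarrow> real \<Rightarrow> 'n \<Rightarrow> nat" where
  "level c t = (\<lambda>i. nat \<lfloor>max 0 (c $ i) * t / ln 2\<rfloor>)"

lemma level_bounds:
  assumes "t \<ge> 0"
  shows "2 ^ level c t i \<le> exp (max 0 (c $ i) * t)" "exp (max 0 (c $ i) * t) \<le> 2 * 2 ^ level c t i"
proof -
  let ?x = "max 0 (c $ i) * t"
  have x: "?x \<ge> 0" using assms by simp
  have l: "ln (2::real) > 0" by simp
  then have "real (level c t i) \<le> ?x / ln 2" "?x / ln 2 \<le> real (Suc (level c t i))"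
    using x divide_nonneg_pos[OF x l] unfolding level_def by linarith+
  then have "real (level c t i) * ln 2 \<le> ?x" "?x \<le> real (Suc (level c t i)) * ln 2"
    using l by (simp_all only: pos_le_divide_eq pos_divide_le_eq)
  moreover have e: "exp (real n * ln 2) = 2 ^ n" for n :: nat
    by (simp add: exp_of_nat_mult)
  ultimately have "2 ^ level c t i \<le> exp ?x" "exp ?x \<le> 2 ^ Suc (level c t i)"
    by (simp_all only: exp_le_cancel_iff flip: e)
  then show "2 ^ level c t i \<le> exp ?x" "exp ?x \<le> 2 * 2 ^ level c t i"
    by simp_all
qed

lemma level_mono: "s \<le> t \<Longrightarrow> level c s \<le> level c t"
  by (auto simp: level_def le_fun_def intro!: nat_mono floor_mono divide_right_mono mult_left_mono)

lemma level_add_le: "level c (s + t) i \<le> level c s i + level c t i + 1"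
proof -
  have "max 0 (c $ i) * (s + t) / ln 2 = max 0 (c $ i) * s / ln 2 + max 0 (c $ i) * t / ln 2"
    by (simp add: distrib_left add_divide_distrib)
  then show ?thesis unfolding level_def by linarith
qed

text \<open>
  The core of the proof. \<open>A\<close> avoids, modulo \<open>\<Lambda>\<close>, the hole of radius \<open>r\<close> around \<open>q\<close> at time \<open>s + L\<close>.
  The covering property at time \<open>s\<close> gives a lattice vector \<open>l\<close> such that \<open>w + l\<close> is mapped near
  \<open>q\<close> for some \<open>w\<close> close to the centre \<open>w0\<close> of the given box. In the expanded coordinates \<open>w\<close> is
  chosen so that it hits \<open>q\<close> exactly; in the contracted ones, where the box may be tiny after
  applying the flow, \<open>w\<close> keeps the coordinates of \<open>w0\<close> and the contraction during the
  last \<open>L\<close> units of time absorbs the error \<open>\<rho>\<close>. The gap \<open>L\<close> before \<open>s\<close> makes the box large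
  compared with \<open>\<rho>\<close>, and the gap \<open>L\<close> after \<open>s + L\<close> makes the subbox of \<open>w\<close> small compared with
  \<open>r\<close>, so that the whole subbox lies in the hole.
\<close>

lemma ex_subcell_in_hole:
  fixes c q :: "real ^ 'n::finite" and \<beta> \<rho> r :: real and L s :: nat and a b :: real
  assumes c: "\<And>i. \<beta> \<le> \<bar>c $ i\<bar>" and \<beta>: "\<beta> > 0" and \<rho>: "\<rho> > 0"
    and L: "exp (- \<beta> * L) * \<rho> < 1 / 2" "exp (- \<beta> * L) * (\<rho> + 2) < r"
    and times: "0 \<le> a" "a + L \<le> s" "s + 2 * L \<le> b"
    and cov: "\<And>v. \<exists>l\<in>\<Lambda>. \<forall>i. \<bar>exp (c $ i * s) * l $ i - v $ i\<bar> \<le> \<rho>"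
    and A: "\<And>w l. w \<in> A \<Longrightarrow> l \<in> \<Lambda> \<Longrightarrow> \<exists>i. r \<le> \<bar>exp (c $ i * real (s + L)) * (w $ i + l $ i) - q $ i\<bar>"
  shows "\<exists>z'. z' \<in> refine (level c a) (level c b) -` {z} - cell (level c b) ` A"
proof -
  define e where "e = exp (- \<beta> * L)"
  have e: "e > 0" by (simp add: e_def)
  define w0 :: "real ^ 'n" where "w0 = (\<chi> i. (of_int (z i) + 1 / 2) / 2 ^ level c a i)"
  define v :: "real ^ 'n" where "v = (\<chi> i. exp (- (c $ i * L)) * q $ i - exp (c $ i * s) * w0 $ i)"
  obtain l where l: "l \<in> \<Lambda>" "\<And>i. \<bar>exp (c $ i * s) * l $ i - v $ i\<bar> \<le> \<rho>"
    using cov by blast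
  define w :: "real ^ 'n" where
    "w = (\<chi> i. if c $ i > 0 then exp (- (c $ i * real (s + L))) * q $ i - l $ i else w0 $ i)"
  have exps: "exp (c $ i * real (s + L)) = exp (c $ i * L) * exp (c $ i * s)" for i
    unfolding exp_add[symmetric] by (simp add: distrib_left)
  have exps': "exp (c $ i * s) * exp (- (c $ i * real (s + L))) = exp (- (c $ i * L))" for i
    by (simp add: distrib_left flip: exp_add)
  \<comment> \<open>\<open>e\<close> bounds the contraction in every direction, forward or backward, over time \<open>L\<close> or more.\<close>
  have contr: "exp (- \<bar>c $ i\<bar> * t) \<le> e" if "t \<ge> L" for i and t :: real
  proof -
    have "\<beta> * L \<le> \<bar>c $ i\<bar> * t"
      using c[of i] \<beta> that by (intro mult_mono) auto
    then show ?thesis by (simp add: e_def)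
  qed
  have ab: "a \<le> b" "0 \<le> b" using times by auto
  have le: "level c a \<le> level c b"
    using ab by (intro level_mono)
  \<comment> \<open>\<open>w\<close> is less than half a side away from the centre \<open>w0\<close>, hence in the given box.\<close>
  have close: "2 ^ level c a i * \<bar>w $ i - w0 $ i\<bar> < 1 / 2" for i
  proof (cases "c $ i > 0")
    case True
    have "exp (c $ i * s) * \<bar>w $ i - w0 $ i\<bar> = \<bar>exp (c $ i * s) * (w $ i - w0 $ i)\<bar>"
      by (simp add: abs_mult)
    also have "exp (c $ i * s) * (w $ i - w0 $ i) = v $ i - exp (c $ i * s) * l $ i"
      using True by (simp add: w_def v_def right_diff_distrib exps' flip: mult.assoc del: of_nat_add)
    also have "\<bar>\<dots>\<bar> \<le> \<rho>" using l(2)[of i] by (simp add: abs_minus_commute)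
    finally have 1: "exp (c $ i * s) * \<bar>w $ i - w0 $ i\<bar> \<le> \<rho>" .
    have "2 ^ level c a i \<le> exp (c $ i * a)"
      using level_bounds(1)[OF times(1), of c i] True by simp
    also have "exp (c $ i * a) = exp (- \<bar>c $ i\<bar> * (s - a)) * exp (c $ i * s)"
      using True by (simp add: right_diff_distrib flip: exp_add)
    also have "\<dots> \<le> e * exp (c $ i * s)"
      using times by (intro mult_right_mono contr) auto
    finally have "2 ^ level c a i * \<bar>w $ i - w0 $ i\<bar> \<le> e * exp (c $ i * s) * \<bar>w $ i - w0 $ i\<bar>"
      by (rule mult_right_mono) simp
    also have "\<dots> \<le> e * \<rho>"
      using mult_left_mono[OF 1, of e] e by (simp add: mult.assoc)
    also have "\<dots> < 1 / 2" using L(1) by (simp add: e_def)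
    finally show ?thesis .
  qed (simp add: w_def)
  have "cell (level c a) w = z"
  proof
    fix i
    let ?k = "(2::real) ^ level c a i"
    have "?k * w0 $ i = of_int (z i) + 1 / 2" by (simp add: w0_def)
    moreover have "\<bar>?k * w $ i - ?k * w0 $ i\<bar> < 1 / 2"
      using close[of i] by (simp add: abs_mult flip: right_diff_distrib)
    ultimately show "cell (level c a) w i = z i"
      unfolding cell_def by linarith
  qed
  then have "cell (level c b) w \<in> refine (level c a) (level c b) -` {z}"
    using refine_cell[OF le] by simp
  moreover have "cell (level c b) w \<notin> cell (level c b) ` A"
  proof
    assume "cell (level c b) w \<in> cell (level c b) ` A"
    then obtain w' where w': "w' \<in> A" "cell (level c b) w' = cell (level c b) w"
      by auto
    have "\<bar>exp (c $ i * real (s + L)) * (w' $ i + l $ i) - q $ i\<bar> < r" for i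
    proof -
      let ?E = "exp (c $ i * real (s + L))"
      have d: "2 ^ level c b i * \<bar>w' $ i - w $ i\<bar> < 1"
        using w'(2) by (intro abs_diff_less_if_cell_eq) simp
      have E: "?E * \<bar>w' $ i - w $ i\<bar> \<le> 2 * e"
      proof (cases "c $ i > 0")
        case True
        have "exp (c $ i * b) * \<bar>w' $ i - w $ i\<bar> \<le> 2 * 2 ^ level c b i * \<bar>w' $ i - w $ i\<bar>"
          using level_bounds(2)[OF ab(2), of c i] True by (intro mult_right_mono) auto
        also have "\<dots> \<le> 2" using d by simp
        finally have 1: "exp (c $ i * b) * \<bar>w' $ i - w $ i\<bar> \<le> 2" .
        have "?E = exp (- \<bar>c $ i\<bar> * (b - real (s + L))) * exp (c $ i * b)"
          using True by (simp add: right_diff_distrib flip: exp_add)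
        also have "\<dots> \<le> e * exp (c $ i * b)"
          using times by (intro mult_right_mono contr) auto
        finally have "?E * \<bar>w' $ i - w $ i\<bar> \<le> e * exp (c $ i * b) * \<bar>w' $ i - w $ i\<bar>"
          by (rule mult_right_mono) simp
        also have "\<dots> \<le> e * 2"
          using mult_left_mono[OF 1, of e] e by (simp add: mult.assoc)
        finally show ?thesis by simp
      next
        case False
        then have "?E \<le> e" using contr[of "real (s + L)" i] by simp
        moreover have "\<bar>w' $ i - w $ i\<bar> \<le> 1"
          using d False by (simp add: level_def)
        ultimately have "?E * \<bar>w' $ i - w $ i\<bar> \<le> e * 1"
          using e by (intro mult_mono) auto
        then show ?thesis using e by simp
      qed
      have F: "\<bar>?E * (w $ i + l $ i) - q $ i\<bar> \<le> e * \<rho>"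
      proof (cases "c $ i > 0")
        case True
        have "?E * (w $ i + l $ i) = q $ i"
          using True by (simp add: w_def exp_minus)
        then show ?thesis using e \<rho> by simp
      next
        case False
        have "?E * (w $ i + l $ i) - q $ i = exp (c $ i * L) * (exp (c $ i * s) * l $ i - v $ i)"
          using False by (simp add: w_def v_def exps right_diff_distrib distrib_left exp_minus
            del: of_nat_add)
        moreover have "exp (c $ i * L) \<le> e"
          using contr[of "real L" i] False by simp
        ultimately show ?thesis
          using l(2)[of i] e by (auto simp: abs_mult intro!: mult_mono)
      qed
      have "?E * (w' $ i + l $ i) - q $ i = ?E * (w' $ i - w $ i) + (?E * (w $ i + l $ i) - q $ i)"
        by (simp add: algebra_simps)
      also have "\<bar>\<dots>\<bar> \<le> \<bar>?E * (w' $ i - w $ i)\<bar> + \<bar>?E * (w $ i + l $ i) - q $ i\<bar>"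
        by (rule abs_triangle_ineq)
      also have "\<dots> \<le> 2 * e + e * \<rho>"
        using E F by (simp add: abs_mult)
      also have "\<dots> < r" using L(2) by (simp add: e_def algebra_simps)
      finally show ?thesis .
    qed
    then show False using A[OF w'(1) l(1)] by (meson linorder_not_le)
  qed
  ultimately show ?thesis by blast
qed

section \<open>Covering radii of lattices in a compact set\<close>

text \<open>
  The covering radius is taken with respect to the supremum norm, as all boxes are parallel to the
  coordinate axes.
\<close>

definition covering_radius_le :: "(real ^ 'n) set \<Rightarrow> real \<Rightarrow> bool" where
  "covering_radius_le \<Lambda> \<rho> \<longleftrightarrow> (\<forall>v. \<exists>l\<in>\<Lambda>. \<forall>i. \<bar>l $ i - v $ i\<bar> \<le> \<rho>)"

lemma matrix_inv_mult:
  assumes "invertible A"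
  shows "A ** matrix_inv A = mat 1" "matrix_inv A ** A = mat 1"
  using assms unfolding invertible_def matrix_inv_def
  by (metis (mono_tags, lifting) someI_ex)+

lemma covering_radius_matrix:
  fixes h :: "real ^ 'n::finite ^ 'n"
  assumes h: "h \<in> SL" "\<And>i j. \<bar>h $ i $ j\<bar> \<le> R"
  shows "covering_radius_le ((*v) h ` integer_vectors) (real CARD('n) * R)"
  unfolding covering_radius_le_def
proof (intro allI)
  fix v :: "real ^ 'n"
  define u where "u = matrix_inv h *v v"
  define z :: "real ^ 'n" where "z = (\<chi> i. of_int \<lfloor>u $ i\<rfloor>)"
  have "invertible h"
    using h(1) by (simp add: SL_def invertible_det_nz)
  then have v: "v = h *v u"
    by (simp add: u_def matrix_vector_mul_assoc matrix_inv_mult(1))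
  have "z \<in> integer_vectors" by (simp add: z_def integer_vectors_def)
  moreover have "\<bar>(h *v z) $ i - v $ i\<bar> \<le> real CARD('n) * R" for i
  proof -
    have "\<bar>(h *v z) $ i - v $ i\<bar> = \<bar>\<Sum>j\<in>UNIV. h $ i $ j * (z $ j - u $ j)\<bar>"
      by (simp add: v matrix_vector_mult_def right_diff_distrib sum_subtractf)
    also have "\<dots> \<le> (\<Sum>j\<in>(UNIV :: 'n set). R)"
    proof (rule order_trans[OF sum_abs], rule sum_mono)
      fix j
      have "\<bar>z $ j - u $ j\<bar> \<le> 1" unfolding z_def by simp linarith
      then have "\<bar>h $ i $ j\<bar> * \<bar>z $ j - u $ j\<bar> \<le> R * 1"
        using h(2)[of i j] by (intro mult_mono) auto
      then show "\<bar>h $ i $ j * (z $ j - u $ j)\<bar> \<le> R" by (simp add: abs_mult)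
    qed
    finally show ?thesis by simp
  qed
  ultimately show "\<exists>l\<in>(*v) h ` integer_vectors. \<forall>i. \<bar>l $ i - v $ i\<bar> \<le> real CARD('n) * R"
    by blast
qed

text \<open>
  These sets exhaust the space of lattices. They are open because the change of basis that turns
  \<open>g\<close> into a small basis of its lattice does the same for all nearby matrices.
\<close>

definition bounded_basis :: "real \<Rightarrow> ('n::finite) ulattice set" where
  "bounded_basis R = {x. \<exists>h\<in>SL. (\<forall>i j. \<bar>h $ i $ j\<bar> < R) \<and> lattice_points x = (*v) h ` integer_vectors}"

lemma lattice_points_lattice_of:
  "g \<in> SL \<Longrightarrow> lattice_points (lattice_of g) = (*v) g ` integer_vectors"
  unfolding lattice_of_def by (subst Abs_ulattice_inverse) auto

lemma open_bounded_basis: "open (bounded_basis R :: ('n::finite) ulattice set)"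
proof -
  define \<Gamma> :: "(real ^ 'n ^ 'n) set" where
    "\<Gamma> = {\<gamma> \<in> SL. (*v) \<gamma> ` integer_vectors = integer_vectors}"
  let ?V = "\<lambda>\<gamma> :: real ^ 'n ^ 'n. \<Inter>i. \<Inter>j. {g :: real ^ 'n ^ 'n. \<bar>(g ** \<gamma>) $ i $ j\<bar> < R}"
  have "{g \<in> SL. lattice_of g \<in> bounded_basis R} = SL \<inter> (\<Union>\<gamma>\<in>\<Gamma>. ?V \<gamma>)"
  proof (intro equalityI subsetI)
    fix g :: "real ^ 'n ^ 'n" assume "g \<in> {g \<in> SL. lattice_of g \<in> bounded_basis R}"
    then have g: "g \<in> SL" "lattice_of g \<in> bounded_basis R" by auto
    then obtain h where h: "h \<in> SL" "\<And>i j. \<bar>h $ i $ j\<bar> < R"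
      "(*v) g ` integer_vectors = (*v) h ` integer_vectors"
      unfolding bounded_basis_def by (auto simp: lattice_points_lattice_of)
    define \<gamma> where "\<gamma> = matrix_inv g ** h"
    have inv: "invertible g"
      using g(1) by (simp add: SL_def invertible_det_nz)
    have 1: "g ** \<gamma> = h"
      unfolding \<gamma>_def using inv by (metis matrix_inv_mult(1) matrix_mul_assoc matrix_mul_lid)
    then have "det g * det \<gamma> = det h" by (metis det_mul)
    then have "\<gamma> \<in> SL" using g(1) h(1) by (simp add: SL_def)
    moreover have "(*v) \<gamma> ` integer_vectors = (*v) (matrix_inv g) ` (*v) g ` integer_vectors"
      unfolding h(3) by (simp add: \<gamma>_def image_image matrix_vector_mul_assoc)
    then have "(*v) \<gamma> ` integer_vectors = integer_vectors"
      by (simp add: image_image matrix_vector_mul_assoc matrix_inv_mult(2)[OF inv])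
    ultimately have "\<gamma> \<in> \<Gamma>" by (simp add: \<Gamma>_def)
    then show "g \<in> SL \<inter> (\<Union>\<gamma>\<in>\<Gamma>. ?V \<gamma>)"
      using g(1) h(2) by (auto simp: 1 intro!: bexI[of _ \<gamma>])
  next
    fix g :: "real ^ 'n ^ 'n" assume "g \<in> SL \<inter> (\<Union>\<gamma>\<in>\<Gamma>. ?V \<gamma>)"
    then obtain \<gamma> where g: "g \<in> SL" "\<gamma> \<in> \<Gamma>" "\<And>i j. \<bar>(g ** \<gamma>) $ i $ j\<bar> < R" by auto
    have "g ** \<gamma> \<in> SL" using g by (simp add: SL_def \<Gamma>_def det_mul)
    moreover have "(*v) (g ** \<gamma>) ` integer_vectors = (*v) g ` (*v) \<gamma> ` integer_vectors"
      by (simp add: image_image matrix_vector_mul_assoc)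
    ultimately show "g \<in> {g \<in> SL. lattice_of g \<in> bounded_basis R}"
      using g unfolding bounded_basis_def \<Gamma>_def
      by (auto simp: lattice_points_lattice_of intro!: bexI[of _ "g ** \<gamma>"])
  qed
  moreover have "open (?V \<gamma>)" for \<gamma>
    unfolding matrix_matrix_mult_def
    by (intro open_INT finite_class.finite_UNIV ballI open_Collect_less) (auto intro!: continuous_intros)
  ultimately show ?thesis
    unfolding open_ulattice_def by (auto intro!: openin_open_Int)
qed

text \<open>
  Rounding coefficients with respect to a basis bounds the covering radius by the size of that basis,
  and on a compact set finitely many of the open sets \<open>bounded_basis\<close> suffice.
\<close>

lemma compact_covering_radius:
  fixes K :: "'n::finite ulattice set"
  assumes "compact K"
  obtains \<rho> where "\<rho> > 0" "\<And>x. x \<in> K \<Longrightarrow> covering_radius_le (lattice_points x) \<rho>"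
proof -
  have "\<exists>N::nat. x \<in> bounded_basis (real N)" for x :: "'n ulattice"
  proof -
    obtain g where g: "g \<in> SL" "lattice_points x = (*v) g ` integer_vectors"
      by (rule lattice_points_eq)
    define B where "B = Max (range (\<lambda>(i, j). \<bar>g $ i $ j\<bar>))"
    have "\<bar>g $ i $ j\<bar> \<le> B" for i j
      unfolding B_def by (intro Max_ge finite_imageI finite_class.finite_UNIV) (auto intro: rev_image_eqI[of "(i, j)"])
    moreover obtain N :: nat where "B < real N" using reals_Archimedean2 by blast
    ultimately have "\<forall>i j. \<bar>g $ i $ j\<bar> < real N" by (meson le_less_trans)
    then show ?thesis using g by (auto simp: bounded_basis_def)
  qed
  then have "K \<subseteq> (\<Union>N::nat. bounded_basis (real N))" by blast
  from compactE_image[OF assms open_bounded_basis this]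
  obtain C where C: "finite C" "K \<subseteq> (\<Union>N\<in>C. bounded_basis (real N))"
    by metis
  define R where "R = real (Max (insert 1 C))"
  have R: "R \<ge> 1" "\<And>N. N \<in> C \<Longrightarrow> real N \<le> R"
    using C(1) by (auto simp: R_def)
  show ?thesis
  proof (rule that)
    show "real CARD('n) * R > 0" using R by (intro mult_pos_pos) auto
    fix x assume "x \<in> K"
    then obtain N h where h: "N \<in> C" "h \<in> SL" "\<And>i j. \<bar>h $ i $ j\<bar> < real N"
      "lattice_points x = (*v) h ` integer_vectors"
      using C(2) by (auto simp: bounded_basis_def)
    have "\<bar>h $ i $ j\<bar> \<le> R" for i j
      using h(3)[of i j] R(2)[OF h(1)] by linarith
    then show "covering_radius_le (lattice_points x) (real CARD('n) * R)"
      unfolding h(4) by (intro covering_radius_matrix h(2))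
  qed
qed

section \<open>The diagonal flow\<close>

lemma diag_flow_mult: "diag_flow c t *v w = (\<chi> i. exp (c $ i * t) * w $ i)"
  by (simp add: diag_flow_def matrix_vector_mult_def vec_eq_iff if_distrib[of "\<lambda>a. a * _"] cong: if_cong)

lemma lattice_points_act_diag_flow:
  assumes "(\<Sum>j\<in>UNIV. c $ j) = 0"
  shows "lattice_points ((act (diag_flow c 1) ^^ n) x) = (*v) (diag_flow c n) ` lattice_points x"
proof (induction n)
  case 0
  then show ?case by (simp add: diag_flow_mult)
next
  case (Suc n)
  then show ?case
    by (simp add: act.rep_eq diag_flow_in_SL[OF assms] image_image diag_flow_mult
        distrib_left exp_add mult.assoc)
qed

lemma matrix_inv_diag_flow: "matrix_inv (diag_flow c t) = diag_flow c (- t)"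
proof -
  have 1: "diag_flow c s ** diag_flow c (- s) = mat 1" for s
    by (rule matrix_eq[THEN iffD2])
       (simp add: diag_flow_mult vec_eq_iff flip: matrix_vector_mul_assoc mult.assoc exp_add)
  show ?thesis
    using 1[of t] 1[of "- t"] by (metis add.inverse_inverse invertible_def matrix_inv_mult(2)
        matrix_mul_assoc matrix_mul_lid matrix_mul_rid)
qed

section \<open>Hausdorff premeasures\<close>

context Metric_space
begin

lemma hausdorff_premeasure_le:
  assumes "A \<subseteq> (\<Union>i. U i)" "\<And>i. U i \<subseteq> M" "\<And>i x y. x \<in> U i \<Longrightarrow> y \<in> U i \<Longrightarrow> d x y \<le> \<epsilon>"
  shows "hausdorff_premeasure s \<epsilon> A \<le> (\<Sum>i. ennreal (diam (U i) powr s))"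
  unfolding hausdorff_premeasure_def using assms by (intro INF_lower) blast

lemma hausdorff_premeasure_mono:
  assumes "A \<subseteq> B"
  shows "hausdorff_premeasure s \<epsilon> A \<le> hausdorff_premeasure s \<epsilon> B"
  unfolding hausdorff_premeasure_def using assms by (intro INF_superset_mono) auto

lemma diam_bounds:
  assumes "U \<subseteq> M" "\<And>x y. x \<in> U \<Longrightarrow> y \<in> U \<Longrightarrow> d x y \<le> \<epsilon>" "\<epsilon> \<ge> 0"
  shows "0 \<le> diam U" "diam U \<le> \<epsilon>"
proof -
  have "0 \<le> diam U \<and> diam U \<le> \<epsilon>"
  proof (cases "U = {}")
    case False
    then obtain x where x: "x \<in> U" by blast
    let ?D = "(\<lambda>(x, y). d x y) ` (U \<times> U)"
    have le: "a \<le> \<epsilon>" if "a \<in> ?D" for a using that assms(2) by auto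
    then have "bdd_above ?D" by (meson bdd_aboveI)
    moreover have "d x x \<in> ?D" using x by (intro image_eqI[of _ _ "(x, x)"]) auto
    ultimately have "d x x \<le> Sup ?D" by (rule cSup_upper[rotated])
    then have "0 \<le> Sup ?D" using nonneg[of x x] by linarith
    moreover have "Sup ?D \<le> \<epsilon>" using x by (intro cSup_least le) auto
    ultimately show ?thesis
      using False by (simp add: diam_def)
  qed (use assms(3) in \<open>simp add: diam_def\<close>)
  then show "0 \<le> diam U" "diam U \<le> \<epsilon>" by auto
qed

lemma hausdorff_premeasure_finite_cover:
  assumes s: "s > 0" and A: "A \<subseteq> (\<Union>z\<in>Z. V z)" and Z: "finite Z"
    and V: "\<And>z. z \<in> Z \<Longrightarrow> V z \<subseteq> M" "\<And>z x y. z \<in> Z \<Longrightarrow> x \<in> V z \<Longrightarrow> y \<in> V z \<Longrightarrow> d x y \<le> D"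
    and D: "0 \<le> D" "D \<le> \<epsilon>"
  shows "hausdorff_premeasure s \<epsilon> A \<le> ennreal (real (card Z) * D powr s)"
proof -
  obtain f where f: "bij_betw f {..<card Z} Z"
    using Z by (metis atLeast0LessThan ex_bij_betw_nat_finite)
  define U where "U = (\<lambda>i. if i < card Z then V (f i) else {})"
  have fZ: "f i \<in> Z" if "i < card Z" for i
    using f that by (auto simp: bij_betw_def)
  have U: "U i \<subseteq> M" "x \<in> U i \<Longrightarrow> y \<in> U i \<Longrightarrow> d x y \<le> D" for i x y
    using V[of "f i"] fZ[of i] by (auto simp: U_def split: if_splits)
  have "hausdorff_premeasure s \<epsilon> A \<le> (\<Sum>i. ennreal (diam (U i) powr s))"
  proof (rule hausdorff_premeasure_le)
    show "A \<subseteq> (\<Union>i. U i)"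
    proof
      fix a assume "a \<in> A"
      then obtain z where z: "z \<in> Z" "a \<in> V z" using A by blast
      then obtain i where "i < card Z" "f i = z"
        using f by (metis bij_betw_iff_bijections lessThan_iff)
      then show "a \<in> (\<Union>i. U i)" using z by (auto simp: U_def intro!: exI[of _ i])
    qed
  qed (use U D in \<open>force+\<close>)
  also have "\<dots> = (\<Sum>i<card Z. ennreal (diam (U i) powr s))"
    by (rule suminf_finite) (auto simp: U_def diam_def)
  also have "\<dots> \<le> (\<Sum>i<card Z. ennreal (D powr s))"
    using s diam_bounds[OF U D(1)] by (intro sum_mono ennreal_leI powr_mono2) auto
  also have "\<dots> = ennreal (real (card Z) * D powr s)"
    by (simp add: ennreal_mult'' ennreal_of_nat_eq_real_of_nat)
  finally show ?thesis .
qed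

text \<open>
  Near-optimal covers of the \<open>A n\<close>, with errors \<open>e / 2\<^bsup>n+1\<^esup>\<close>, are merged into one sequence.
\<close>

lemma hausdorff_premeasure_UN_le:
  fixes A :: "nat \<Rightarrow> 'a set"
  shows "hausdorff_premeasure s \<epsilon> (\<Union>n. A n) \<le> (\<Sum>n. hausdorff_premeasure s \<epsilon> (A n))"
proof (rule ennreal_le_epsilon)
  fix e :: real
  assume e: "e > 0" and fin: "(\<Sum>n. hausdorff_premeasure s \<epsilon> (A n)) < top"
  have "\<exists>U. A n \<subseteq> (\<Union>i. U i) \<and> (\<forall>i. U i \<subseteq> M \<and> (\<forall>x\<in>U i. \<forall>y\<in>U i. d x y \<le> \<epsilon>)) \<and>
      (\<Sum>i. ennreal (diam (U i) powr s)) < hausdorff_premeasure s \<epsilon> (A n) + e * (1/2) ^ Suc n" for n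
  proof -
    have "hausdorff_premeasure s \<epsilon> (A n) < hausdorff_premeasure s \<epsilon> (A n) + e * (1/2) ^ Suc n"
      using e ennreal_suminf_lessD[OF fin, of n] by (auto simp: less_top)
    from this[unfolded hausdorff_premeasure_def INF_less_iff, folded hausdorff_premeasure_def]
    show ?thesis by blast
  qed
  then obtain U where U: "\<And>n. A n \<subseteq> (\<Union>i. U n i)" "\<And>n i. U n i \<subseteq> M"
      "\<And>n i x y. x \<in> U n i \<Longrightarrow> y \<in> U n i \<Longrightarrow> d x y \<le> \<epsilon>"
    and U_sum: "\<And>n. (\<Sum>i. ennreal (diam (U n i) powr s))
        < hausdorff_premeasure s \<epsilon> (A n) + e * (1/2) ^ Suc n"
    by metis
  define W where "W = (\<lambda>k. case_prod U (prod_decode k))"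
  have "(\<Union>n. A n) \<subseteq> (\<Union>k. W k)"
  proof
    fix a assume "a \<in> (\<Union>n. A n)"
    then obtain n i where "a \<in> U n i" using U(1) by blast
    then have "a \<in> W (prod_encode (n, i))" by (simp add: W_def)
    then show "a \<in> (\<Union>k. W k)" by blast
  qed
  then have "hausdorff_premeasure s \<epsilon> (\<Union>n. A n) \<le> (\<Sum>k. ennreal (diam (W k) powr s))"
    using U(2,3) by (intro hausdorff_premeasure_le) (auto simp: W_def split: prod.splits)
  also have "\<dots> = (\<Sum>n. \<Sum>i. ennreal (diam (U n i) powr s))"
    unfolding W_def
    by (rule suminf_ennreal_2dimen[where f = "\<lambda>p. ennreal (diam (case_prod U p) powr s)"]) simp
  also have "\<dots> \<le> (\<Sum>n. hausdorff_premeasure s \<epsilon> (A n) + ennreal (e * (1/2) ^ Suc n))"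
    using U_sum by (intro suminf_le allI less_imp_le) auto
  also have "\<dots> = (\<Sum>n. hausdorff_premeasure s \<epsilon> (A n)) + (\<Sum>n. ennreal e * ennreal ((1/2) ^ Suc n))"
    using e by (subst suminf_add[symmetric])
      (auto simp del: ennreal_suminf_cmult simp add: ennreal_mult[symmetric])
  also have "\<dots> = (\<Sum>n. hausdorff_premeasure s \<epsilon> (A n)) + ennreal e"
    unfolding ennreal_suminf_cmult
    by (subst suminf_ennreal_eq[OF zero_le_power power_half_series]) auto
  finally show "hausdorff_premeasure s \<epsilon> (\<Union>n. A n)
      \<le> (\<Sum>n. hausdorff_premeasure s \<epsilon> (A n)) + ennreal e" .
qed

lemma hausdorff_dim_UN_le:
  fixes A :: "nat \<Rightarrow> 'a set"
  assumes "s > 0" "F \<subseteq> (\<Union>n. A n)" "\<And>n \<epsilon>. \<epsilon> > 0 \<Longrightarrow> hausdorff_premeasure s \<epsilon> (A n) = 0"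
  shows "hausdorff_dim F \<le> ereal s"
proof -
  have "hausdorff_premeasure s \<epsilon> F = 0" if "\<epsilon> > 0" for \<epsilon>
  proof -
    have "hausdorff_premeasure s \<epsilon> F \<le> hausdorff_premeasure s \<epsilon> (\<Union>n. A n)"
      by (rule hausdorff_premeasure_mono[OF assms(2)])
    also have "\<dots> \<le> (\<Sum>n. hausdorff_premeasure s \<epsilon> (A n))"
      by (rule hausdorff_premeasure_UN_le)
    finally show ?thesis using assms(3)[OF that] by simp
  qed
  then have "hausdorff_measure s F = 0"
    unfolding hausdorff_measure_def by (auto simp: bot_ennreal[symmetric] SUP_eq_const intro!: SUP_eqI)
  then show ?thesis
    unfolding hausdorff_dim_def using assms(1) by (intro INF_lower) auto
qed

end

section \<open>Visits to compact sets\<close>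

lemma integral_empirical_measure:
  fixes f :: "'n::finite ulattice \<Rightarrow> real"
  assumes "T \<ge> 1" "f \<in> borel_measurable borel"
  shows "(\<integral>z. f z \<partial>empirical_measure c T x) = (\<Sum>i<T. f ((act (diag_flow c 1) ^^ i) x)) / real T"
  unfolding empirical_measure_def using assms
  by (subst integral_distr)
    (auto simp: integral_uniform_count_measure measurable_def sets_uniform_count_measure
      space_uniform_count_measure)

lemma Cc_imp_C0:
  assumes "f \<in> Cc_functions"
  shows "f \<in> C0_functions"
proof -
  have "\<exists>K. compact K \<and> (\<forall>z. z \<notin> K \<longrightarrow> \<bar>f z\<bar> < \<epsilon>)" if "\<epsilon> > 0" for \<epsilon> :: real
  proof (intro exI conjI allI impI)
    show "compact (closure {z. f z \<noteq> 0})" using assms by (simp add: Cc_functions_def)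
    fix z assume "z \<notin> closure {z. f z \<noteq> 0}"
    then have "f z = 0" using closure_subset[of "{z. f z \<noteq> 0}"] by blast
    then show "\<bar>f z\<bar> < \<epsilon>" using that by simp
  qed
  then show ?thesis using assms by (auto simp: C0_functions_def Cc_functions_def)
qed

text \<open>
  Each time outside the support of \<open>f\<close> contributes 0 to the average of \<open>f\<close> along the orbit and every
  other time at most 1. A limit of these averages above \<open>1 - \<kappa>\<close> thus bounds the proportion of the
  former times by \<open>\<kappa>\<close>. Finitely many terms of the sequence are dropped so that the bound holds for
  all \<open>k\<close>.
\<close>

lemma frequent_visits:
  fixes f :: "'n::finite ulattice \<Rightarrow> real"
  assumes \<mu>: "\<mu> \<in> accumulation_measures c x" and f: "f \<in> Cc_functions" "\<And>z. f z \<le> 1"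
    and mass: "(\<integral>z. f z \<partial>\<mu>) > 1 - \<kappa>"
  shows "\<exists>T :: nat \<Rightarrow> nat. filterlim T at_top sequentially \<and>
    (\<forall>k. real (card {n. n < T k \<and> (act (diag_flow c 1) ^^ n) x \<notin> closure {z. f z \<noteq> 0}}) \<le> \<kappa> * T k)"
proof -
  let ?x = "\<lambda>n. (act (diag_flow c 1) ^^ n) x"
  obtain T :: "nat \<Rightarrow> nat" where T: "\<And>k. T k \<ge> 1" "filterlim T at_top sequentially"
    "weak_star_limit (\<lambda>k. empirical_measure c (T k) x) \<mu>"
    using \<mu> unfolding accumulation_measures_def by blast
  have f_meas: "f \<in> borel_measurable borel"
    using f(1) by (intro borel_measurable_continuous_onI) (simp add: Cc_functions_def)
  have "(\<lambda>k. \<integral>z. f z \<partial>empirical_measure c (T k) x) \<longlonglongrightarrow> (\<integral>z. f z \<partial>\<mu>)"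
    using T(3) Cc_imp_C0[OF f(1)] unfolding weak_star_limit_def by blast
  then have "eventually (\<lambda>k. (\<integral>z. f z \<partial>empirical_measure c (T k) x) > 1 - \<kappa>) sequentially"
    using mass by (rule order_tendstoD)
  then obtain k0 where k0: "\<And>k. k \<ge> k0 \<Longrightarrow> (\<integral>z. f z \<partial>empirical_measure c (T k) x) > 1 - \<kappa>"
    by (auto simp: eventually_sequentially)
  show ?thesis
  proof (intro exI[of _ "\<lambda>k. T (k + k0)"] conjI allI)
    show "filterlim (\<lambda>k. T (k + k0)) at_top sequentially"
      by (rule filterlim_compose[OF T(2)]) (rule filterlim_add_const_nat_at_top)
    fix k
    let ?T = "T (k + k0)"
    let ?N = "{n. n < ?T \<and> ?x n \<notin> closure {z. f z \<noteq> 0}}"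
    have "(\<Sum>n<?T. f (?x n)) \<le> (\<Sum>n<?T. if n \<in> ?N then 0 else 1)"
    proof (rule sum_mono)
      fix n assume "n \<in> {..<?T}"
      moreover have "f (?x n) = 0 \<or> ?x n \<in> closure {z. f z \<noteq> 0}"
        using closure_subset[of "{z. f z \<noteq> 0}"] by blast
      ultimately show "f (?x n) \<le> (if n \<in> ?N then 0 else 1)"
        using f(2)[of "?x n"] by auto
    qed
    also have "\<dots> = real ?T - real (card ?N)"
    proof -
      have "(\<Sum>n<?T. if n \<in> ?N then 0 else 1) = (\<Sum>n<?T. 1 - (if n \<in> ?N then 1 else 0 :: real))"
        by (intro sum.cong) auto
      also have "\<dots> = real ?T - real (card ({..<?T} \<inter> ?N))"
        by (simp add: sum_subtractf sum.If_cases Int_def)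
      also have "{..<?T} \<inter> ?N = ?N" by auto
      finally show ?thesis .
    qed
    finally have "(\<Sum>n<?T. f (?x n)) \<le> real ?T - real (card ?N)" .
    moreover have "(\<Sum>n<?T. f (?x n)) / real ?T > 1 - \<kappa>"
      using k0[of "k + k0"] integral_empirical_measure[OF T(1) f_meas, of c "k + k0" x] by simp
    then have "(\<Sum>n<?T. f (?x n)) > (1 - \<kappa>) * real ?T"
      using T(1)[of "k + k0"] by (simp add: pos_less_divide_eq)
    ultimately show "real (card ?N) \<le> \<kappa> * real ?T" by (simp add: left_diff_distrib)
  qed
qed

lemma integral_exhaustion_tendsto_1:
  fixes \<psi> :: "nat \<Rightarrow> 'a::topological_space \<Rightarrow> real"
  assumes \<mu>: "\<mu> \<in> borel_prob_measures"
    and \<psi>: "\<And>i. continuous_on UNIV (\<psi> i)" "\<And>i z. 0 \<le> \<psi> i z" "\<And>i z. \<psi> i z \<le> 1"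
    and inc: "incseq (\<lambda>i. \<psi> i -` {1})" and cover: "(\<Union>i. \<psi> i -` {1}) = UNIV"
  shows "(\<lambda>i. \<integral>z. \<psi> i z \<partial>\<mu>) \<longlonglongrightarrow> 1"
proof -
  interpret prob_space \<mu> using \<mu> by (simp add: borel_prob_measures_def)
  have sets: "sets \<mu> = sets borel" using \<mu> by (simp add: borel_prob_measures_def)
  have meas: "\<psi> i \<in> borel_measurable \<mu>" for i
    using borel_measurable_continuous_onI[OF \<psi>(1)] measurable_cong_sets[OF sets refl] by blast
  have "(\<lambda>i. \<integral>z. \<psi> i z \<partial>\<mu>) \<longlonglongrightarrow> (\<integral>z. 1 \<partial>\<mu>)"
  proof (rule integral_dominated_convergence[where w = "\<lambda>_. 1"])
    show "AE z in \<mu>. (\<lambda>i. \<psi> i z) \<longlonglongrightarrow> 1"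
    proof (rule AE_I2)
      fix z
      obtain i where "\<psi> i z = 1" using cover by blast
      then have "\<psi> j z = 1" if "j \<ge> i" for j
        using incseqD[OF inc that] by auto
      then show "(\<lambda>i. \<psi> i z) \<longlonglongrightarrow> 1"
        by (intro tendsto_eventually) (auto simp: eventually_sequentially)
    qed
  qed (use meas \<psi> in auto)
  then show ?thesis by (simp add: prob_space)
qed

section \<open>Counting boxes\<close>

text \<open>
  Counted relative to the \<open>2\<^bsup>\<Sum>k\<^sub>i\<^esup>\<close> boxes in a unit cube, the covering number of \<open>A\<close> never increases from
  one step to the next, and at a good step it loses the proportion \<open>2\<^sup>-\<^sup>D\<close> because one out of at
  most \<open>2\<^sup>D\<close> subboxes is missing.
\<close>

lemma card_cells_iterate:
  fixes k :: "nat \<Rightarrow> 'n::finite \<Rightarrow> nat"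
  assumes mono: "\<And>j. k j \<le> k (Suc j)"
    and D: "\<And>j. (\<Sum>i\<in>UNIV. k (Suc j) i - k j i) \<le> D"
    and fin: "finite (cell (k j0) ` A)"
    and good: "\<And>j z. j \<ge> j0 \<Longrightarrow> good j \<Longrightarrow>
        \<exists>z'. z' \<in> refine (k j) (k (Suc j)) -` {z} - cell (k (Suc j)) ` A"
    and j: "j0 \<le> j"
  shows "finite (cell (k j) ` A) \<and> real (card (cell (k j) ` A))
    \<le> real (card (cell (k j0) ` A)) * 2 ^ (\<Sum>i\<in>UNIV. k j i) * (1 - 1 / 2 ^ D) ^ card {i \<in> {j0..<j}. good i}"
  using j
proof (induction j rule: dec_induct)
  case base
  then show ?case using fin by (simp add: mult_le_cancel_left1)
next
  case (step j)
  let ?a = "1 - 1 / 2 ^ D :: real" and ?g = "\<lambda>j. card {i \<in> {j0..<j}. good i}"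
  let ?\<Delta> = "\<Sum>i\<in>UNIV. k (Suc j) i - k j i"
  define h :: nat where "h = (if good j then 1 else 0)"
  have h: "h \<le> card (refine (k j) (k (Suc j)) -` {z} - cell (k (Suc j)) ` A)" for z
  proof (cases "good j")
    case True
    then have "refine (k j) (k (Suc j)) -` {z} - cell (k (Suc j)) ` A \<noteq> {}"
      using good[of j z] step.hyps by auto
    then have "card (refine (k j) (k (Suc j)) -` {z} - cell (k (Suc j)) ` A) > 0"
      using card_refine_vimage(1)[of "k j" "k (Suc j)" z] by (meson card_gt_0_iff finite_Diff)
    then show ?thesis by (simp add: h_def)
  qed (simp add: h_def)
  have fin_j: "finite (cell (k j) ` A)" using step.IH by simp
  have fin': "finite (cell (k (Suc j)) ` A)"
    by (rule card_cells_refine(1)[OF mono fin_j h])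
  have sum_k: "(\<Sum>i\<in>UNIV. k (Suc j) i) = (\<Sum>i\<in>UNIV. k j i) + ?\<Delta>"
    unfolding sum.distrib[symmetric] using mono[of j] by (intro sum.cong) (auto simp: le_fun_def)
  have "{i \<in> {j0..<Suc j}. good i} = (if good j then {j} else {}) \<union> {i \<in> {j0..<j}. good i}"
    using step.hyps by (auto simp: less_Suc_eq)
  then have g: "?g (Suc j) = ?g j + h"
    by (simp add: h_def)
  \<comment> \<open>One subbox out of \<open>2\<^sup>\<Delta>\<close> is at least the proportion \<open>2\<^sup>-\<^sup>D\<close> of them.\<close>
  have "real (2 ^ ?\<Delta> - h) \<le> 2 ^ ?\<Delta> * ?a ^ h"
  proof (cases "good j")
    case True
    have "(2::real) ^ ?\<Delta> \<le> 2 ^ D" using D[of j] by (intro power_increasing) auto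
    then have "(2::real) ^ ?\<Delta> / 2 ^ D \<le> 1" by simp
    then show ?thesis using True by (simp add: h_def of_nat_diff right_diff_distrib)
  qed (simp add: h_def)
  then have "real (card (cell (k j) ` A)) * real (2 ^ ?\<Delta> - h)
      \<le> (real (card (cell (k j0) ` A)) * 2 ^ (\<Sum>i\<in>UNIV. k j i) * ?a ^ ?g j) * (2 ^ ?\<Delta> * ?a ^ h)"
    using step.IH by (intro mult_mono) auto
  moreover have "real (card (cell (k (Suc j)) ` A)) \<le> real (card (cell (k j) ` A) * (2 ^ ?\<Delta> - h))"
    by (intro of_nat_mono card_cells_refine(2)[OF mono fin_j h])
  ultimately show ?case
    using fin' unfolding sum_k g power_add by (simp add: mult_ac)
qed

text \<open>
  The Hausdorff premeasure has to be bounded with sets of equal diameter, so the adapted boxes are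
  finally cut into cubes of their smallest side. The factor gained by the holes survives.
\<close>

lemma card_cells_cubes:
  fixes k :: "'n::finite \<Rightarrow> nat"
  assumes "\<And>i. k i \<le> m" "finite (cell k ` A)"
  shows "finite (cell (\<lambda>_. m) ` A)"
    and "card (cell (\<lambda>_. m) ` A) * 2 ^ (\<Sum>i\<in>UNIV. k i) \<le> card (cell k ` A) * 2 ^ (CARD('n) * m)"
proof -
  have le: "k \<le> (\<lambda>_. m)" using assms(1) by (simp add: le_fun_def)
  note * = card_cells_refine[OF le assms(2), of 0]
  show "finite (cell (\<lambda>_. m) ` A)" using *(1) by simp
  have "(\<Sum>i\<in>UNIV. m - k i) + (\<Sum>i\<in>UNIV. k i) = CARD('n) * m"
    unfolding sum.distrib[symmetric] using assms(1) by simp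
  then have "2 ^ (CARD('n) * m) = (2::nat) ^ (\<Sum>i\<in>UNIV. m - k i) * 2 ^ (\<Sum>i\<in>UNIV. k i)"
    by (metis power_add)
  then show "card (cell (\<lambda>_. m) ` A) * 2 ^ (\<Sum>i\<in>UNIV. k i) \<le> card (cell k ` A) * 2 ^ (CARD('n) * m)"
    using *(2) by (simp add: mult.assoc[symmetric])
qed

text \<open>
  A bad block contains \<open>L\<close> consecutive times without a visit, and those of different blocks are
  distinct. With at most \<open>T / 8\<close> such times and blocks of length \<open>4L\<close>, at most about half of the
  blocks are bad.
\<close>

lemma card_good_blocks:
  fixes L T :: nat
  assumes L: "L > 0" and bad: "real (card {n. n < T \<and> \<not> V n}) \<le> T / 8"
  defines "J \<equiv> T div (4 * L)"
  shows "real (card {j \<in> {j0..<J}. \<exists>s. j * (4 * L) + L \<le> s \<and> s < j * (4 * L) + 2 * L \<and> V s})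
    \<ge> real J / 2 - (real j0 + 1)"
proof -
  let ?good = "\<lambda>j. \<exists>s. j * (4 * L) + L \<le> s \<and> s < j * (4 * L) + 2 * L \<and> V s"
  define B where "B = {j. j < J \<and> \<not> ?good j}"
  let ?f = "\<lambda>(j, i). j * (4 * L) + (L + i)"
  have "inj_on ?f (B \<times> {..<L})"
  proof (rule inj_onI, clarsimp)
    fix j i j' i' assume *: "i < L" "i' < L" "j * (4 * L) + i = j' * (4 * L) + i'"
    have "j = (j * (4 * L) + i) div (4 * L)" using *(1) by simp
    moreover have "j' = (j' * (4 * L) + i') div (4 * L)" using *(2) by simp
    ultimately have "j = j'" using *(3) by metis
    then show "j = j' \<and> i = i'" using *(3) by simp
  qed
  moreover have "?f ` (B \<times> {..<L}) \<subseteq> {n. n < T \<and> \<not> V n}"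
  proof clarsimp
    fix j i assume j: "j \<in> B" and i: "i < L"
    have "(j + 1) * (4 * L) \<le> J * (4 * L)"
      using j by (intro mult_right_mono) (auto simp: B_def)
    also have "\<dots> \<le> T" by (simp add: J_def)
    finally have "(j + 1) * (4 * L) \<le> T" .
    then have "j * (4 * L) + (L + i) < T" using i by (simp add: distrib_right)
    moreover have "\<not> V (j * (4 * L) + (L + i))"
      using j i unfolding B_def by force
    ultimately show "j * (4 * L) + (L + i) < T \<and> \<not> V (j * (4 * L) + (L + i))" by simp
  qed
  ultimately have "card (B \<times> {..<L}) \<le> card {n. n < T \<and> \<not> V n}"
    by (intro card_inj_on_le) auto
  then have "real (card B) * L \<le> T / 8"
    using bad by (simp add: card_cartesian_product flip: of_nat_mult)
  moreover have "T < (J + 1) * (4 * L)"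
    using L unfolding J_def by (metis add.commute dividend_less_times_div mult.commute mult_pos_pos
        plus_1_eq_Suc zero_less_numeral mult_Suc_right)
  then have "real T \<le> real ((J + 1) * (4 * L))"
    by (simp only: of_nat_le_iff less_imp_le)
  then have "real T \<le> (real J + 1) * (4 * real L)" by (simp add: algebra_simps)
  ultimately have "real (card B) * L \<le> ((real J + 1) / 2) * L" by simp
  then have B: "real (card B) \<le> (real J + 1) / 2" using L by simp
  have "{..<J} \<subseteq> {..<j0} \<union> {j \<in> {j0..<J}. ?good j} \<union> B"
    by (auto simp: B_def)
  then have "card {..<J} \<le> card ({..<j0} \<union> {j \<in> {j0..<J}. ?good j} \<union> B)"
    by (intro card_mono) (auto simp: B_def)
  also have "\<dots> \<le> card {..<j0} + card {j \<in> {j0..<J}. ?good j} + card B"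
    by (meson add_le_mono1 card_Un_le le_trans)
  finally show ?thesis using B by simp
qed

text \<open>
  The bound \<open>R\<close> restricts \<open>w\<close> to representatives modulo \<open>\<Lambda>\<close>, so that finitely many boxes suffice.
  The second condition keeps the orbit of the grid \<open>\<Lambda> + w\<close> out of a cubic hole.
\<close>

definition avoiding ::
  "real ^ 'n \<Rightarrow> (real ^ 'n) set \<Rightarrow> real ^ 'n \<Rightarrow> real \<Rightarrow> real \<Rightarrow> nat \<Rightarrow> (real ^ 'n) set" where
  "avoiding c \<Lambda> q r R n0 = {w. (\<forall>i. \<bar>w $ i\<bar> \<le> R) \<and>
    (\<forall>n\<ge>n0. \<forall>l\<in>\<Lambda>. \<exists>i. r \<le> \<bar>exp (c $ i * real n) * (w $ i + l $ i) - q $ i\<bar>)}"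

text \<open>
  The constant \<open>C\<close> may depend on \<open>\<Lambda>\<close>, \<open>R\<close> and \<open>n0\<close>, but the rate \<open>2\<^sup>-\<^sup>D / 2\<close> per block does not; this
  is the source of the uniformity of the dimension bound. The cubes have the side given by the
  fastest direction \<open>i0\<close>.
\<close>

lemma card_cubes_avoiding:
  fixes c q :: "real ^ 'n::finite" and \<Lambda> :: "(real ^ 'n) set" and L n0 :: nat and \<beta> \<rho> r R :: real
  assumes c: "\<And>i. \<beta> \<le> \<bar>c $ i\<bar>" and \<beta>: "\<beta> > 0" and \<rho>: "\<rho> > 0" and L0: "L > 0"
    and L: "exp (- \<beta> * L) * \<rho> < 1 / 2" "exp (- \<beta> * L) * (\<rho> + 2) < r"
    and D: "D = (\<Sum>i\<in>UNIV. level c (real (4 * L)) i + 1)"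
    and i0: "\<And>i. c $ i \<le> c $ i0"
  defines "A \<equiv> avoiding c \<Lambda> q r R n0"
  obtains C where "C \<ge> 0" "\<And>J T. J = T div (4 * L) \<Longrightarrow> n0 \<le> J \<Longrightarrow>
      real (card {n. n < T \<and> \<not> covering_radius_le ((*v) (diag_flow c (real n)) ` \<Lambda>) \<rho>}) \<le> T / 8 \<Longrightarrow>
      finite (cell (\<lambda>_. level c (real (J * (4 * L))) i0) ` A) \<and>
      real (card (cell (\<lambda>_. level c (real (J * (4 * L))) i0) ` A))
        \<le> C * 2 ^ (CARD('n) * level c (real (J * (4 * L))) i0) * exp (- (real J / (2 * 2 ^ D)))"
proof
  define k where "k = (\<lambda>j. level c (real (j * (4 * L))))"
  define V where "V = (\<lambda>n. covering_radius_le ((*v) (diag_flow c (real n)) ` \<Lambda>) \<rho>)"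
  define good where "good = (\<lambda>j. \<exists>s. j * (4 * L) + L \<le> s \<and> s < j * (4 * L) + 2 * L \<and> V s)"
  define \<theta> where "\<theta> = 1 / (2::real) ^ D"
  have \<theta>: "0 \<le> \<theta>" "\<theta> \<le> 1" by (simp_all add: \<theta>_def)
  \<comment> \<open>The factor \<open>exp (n0 + 1)\<close> pays for the blocks before \<open>n0\<close> and for the incomplete last block.\<close>
  define C where "C = real (card (cell (k n0) ` A)) * exp (real n0 + 1)"
  show "C \<ge> 0" by (simp add: C_def)
  have mono: "k j \<le> k (Suc j)" for j
    unfolding k_def by (intro level_mono of_nat_mono mult_right_mono) auto
  have incr: "(\<Sum>i\<in>UNIV. k (Suc j) i - k j i) \<le> D" for j
    unfolding D
  proof (rule sum_mono)
    fix i
    have "k (Suc j) = level c (real (j * (4 * L)) + real (4 * L))"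
      by (simp add: k_def distrib_right add.commute)
    then show "k (Suc j) i - k j i \<le> level c (real (4 * L)) i + 1"
      using level_add_le[of c "real (j * (4 * L))" "real (4 * L)" i] by (simp add: k_def)
  qed
  have fin: "finite (cell (k n0) ` A)"
    by (rule finite_cells_bounded[of _ R]) (simp add: A_def avoiding_def)
  have hole: "\<exists>z'. z' \<in> refine (k j) (k (Suc j)) -` {z} - cell (k (Suc j)) ` A"
    if jg: "j \<ge> n0" "good j" for j z
  proof -
    obtain s where s: "j * (4 * L) + L \<le> s" "s < j * (4 * L) + 2 * L" "V s"
      using jg(2) unfolding good_def by blast
    show ?thesis unfolding k_def
    proof (rule ex_subcell_in_hole[OF c \<beta> \<rho> L, where \<Lambda> = \<Lambda> and s = s and q = q])
      show "0 \<le> real (j * (4 * L))" by simp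
      show "real (j * (4 * L)) + real L \<le> real s"
        using s(1) by (metis of_nat_add of_nat_le_iff)
      have "s + 2 * L \<le> Suc j * (4 * L)" using s(2) by simp
      then show "real (s + 2 * L) \<le> real (Suc j * (4 * L))"
        by (simp only: of_nat_le_iff)
      show "\<exists>l\<in>\<Lambda>. \<forall>i. \<bar>exp (c $ i * real s) * l $ i - v $ i\<bar> \<le> \<rho>" for v
        using s(3) by (auto simp: V_def covering_radius_le_def diag_flow_mult)
      have "j * 1 \<le> j * (4 * L)" using L0 by (intro mult_left_mono) auto
      then have "n0 \<le> s + L" using jg(1) s(1) by linarith
      then show "\<exists>i. r \<le> \<bar>exp (c $ i * real (s + L)) * (w $ i + l $ i) - q $ i\<bar>"
        if wl: "w \<in> A" "l \<in> \<Lambda>" for w l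
        using wl \<open>n0 \<le> s + L\<close> unfolding A_def avoiding_def by blast
    qed
  qed
  fix J T
  assume J: "J = T div (4 * L)" "n0 \<le> J"
    and bad: "real (card {n. n < T \<and> \<not> covering_radius_le ((*v) (diag_flow c (real n)) ` \<Lambda>) \<rho>}) \<le> T / 8"
  define g where "g = card {j \<in> {n0..<J}. good j}"
  define m where "m = k J i0"
  have g: "real g \<ge> real J / 2 - (real n0 + 1)"
    unfolding g_def good_def J(1) by (rule card_good_blocks[OF L0]) (use bad in \<open>simp add: V_def\<close>)
  note it = card_cells_iterate[where k = k and good = good, OF mono incr fin hole J(2), folded \<theta>_def]
  have km: "k J i \<le> m" for i
    unfolding m_def k_def level_def using i0[of i]
    by (intro nat_mono floor_mono divide_right_mono mult_right_mono) auto
  have finJ: "finite (cell (k J) ` A)" using it by simp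
  note cubes = card_cells_cubes[OF km finJ]
  have "real (card (cell (\<lambda>_. m) ` A)) * 2 ^ (\<Sum>i\<in>UNIV. k J i)
      \<le> real (card (cell (k J) ` A)) * 2 ^ (CARD('n) * m)"
    using of_nat_mono[OF cubes(2), where ?'a = real] by simp
  also have "\<dots> \<le> real (card (cell (k n0) ` A)) * 2 ^ (\<Sum>i\<in>UNIV. k J i) * (1 - \<theta>) ^ g * 2 ^ (CARD('n) * m)"
    using it by (intro mult_right_mono) (auto simp: g_def)
  finally have "real (card (cell (\<lambda>_. m) ` A)) * 2 ^ (\<Sum>i\<in>UNIV. k J i)
     \<le> (real (card (cell (k n0) ` A)) * (1 - \<theta>) ^ g * 2 ^ (CARD('n) * m)) * 2 ^ (\<Sum>i\<in>UNIV. k J i)"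
    by (simp add: mult_ac)
  then have 1: "real (card (cell (\<lambda>_. m) ` A)) \<le> real (card (cell (k n0) ` A)) * (1 - \<theta>) ^ g * 2 ^ (CARD('n) * m)"
    by (simp only: mult_le_cancel_right) simp
  have "(1 - \<theta>) ^ g \<le> exp (- \<theta>) ^ g"
    using \<theta> exp_ge_add_one_self[of "- \<theta>"] by (intro power_mono) auto
  also have "\<dots> = exp (- (\<theta> * real g))"
    by (simp add: mult.commute flip: exp_of_nat_mult)
  also have "\<dots> \<le> exp ((real n0 + 1) - \<theta> * (real J / 2))"
  proof -
    define a where "a = \<theta> * (real n0 + 1)"
    have "\<theta> * (real J / 2) - a \<le> \<theta> * real g"
      using mult_left_mono[OF g \<theta>(1)] by (simp only: a_def right_diff_distrib)
    moreover have "a \<le> 1 * (real n0 + 1)"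
      unfolding a_def using \<theta> by (intro mult_right_mono) auto
    ultimately show ?thesis by simp
  qed
  also have "\<dots> = exp (real n0 + 1) * exp (- (real J / (2 * 2 ^ D)))"
    by (simp add: \<theta>_def flip: exp_add)
  finally have 2: "(1 - \<theta>) ^ g \<le> exp (real n0 + 1) * exp (- (real J / (2 * 2 ^ D)))" .
  have "real (card (cell (k n0) ` A)) * (1 - \<theta>) ^ g * 2 ^ (CARD('n) * m)
      \<le> real (card (cell (k n0) ` A)) * (exp (real n0 + 1) * exp (- (real J / (2 * 2 ^ D)))) * 2 ^ (CARD('n) * m)"
    by (intro mult_right_mono mult_left_mono 2) auto
  with 1 have "real (card (cell (\<lambda>_. m) ` A)) \<le> C * 2 ^ (CARD('n) * m) * exp (- (real J / (2 * 2 ^ D)))"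
    by (simp add: C_def mult_ac)
  then show "finite (cell (\<lambda>_. level c (real (J * (4 * L))) i0) ` A) \<and>
      real (card (cell (\<lambda>_. level c (real (J * (4 * L))) i0) ` A))
        \<le> C * 2 ^ (CARD('n) * level c (real (J * (4 * L))) i0) * exp (- (real J / (2 * 2 ^ D)))"
    using cubes(1) by (simp only: m_def k_def)
qed

section \<open>The dimension of the avoiding grids\<close>

abbreviation coset :: "'n::finite ulattice \<Rightarrow> real ^ 'n \<Rightarrow> (real ^ 'n) set" where
  "coset x w \<equiv> (+) w ` lattice_points x"

lemma coset_add_lattice_point:
  assumes "l \<in> lattice_points x"
  shows "coset x (w + l) = coset x w"
proof -
  have "setdist (coset x (w + l)) (coset x w) = 0"
    using assms unfolding setdist_cosets by (intro setdist_eq_0I) auto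
  then show ?thesis
    using Metric_space.zero[OF Metric_space_grid_fibre, of "coset x (w + l)" x "coset x w"]
    by (auto simp: grid_fibre_eq)
qed

lemma premeasure_cosets_le_cubes:
  fixes A :: "(real ^ 'n::finite) set"
  assumes s: "s > 0" and fin: "finite (cell (\<lambda>_. m) ` A)" and \<epsilon>: "real CARD('n) / 2 ^ m \<le> \<epsilon>"
  shows "Metric_space.hausdorff_premeasure (grid_fibre x) setdist s \<epsilon> (coset x ` A)
    \<le> ennreal (real (card (cell (\<lambda>_. m) ` A)) * (real CARD('n) / 2 ^ m) powr s)"
proof (rule Metric_space.hausdorff_premeasure_finite_cover[OF Metric_space_grid_fibre s _ fin _ _ _ \<epsilon>])
  let ?V = "\<lambda>z. coset x ` {w \<in> A. cell (\<lambda>_. m) w = z}"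
  show "coset x ` A \<subseteq> (\<Union>z\<in>cell (\<lambda>_. m) ` A. ?V z)" by blast
  show "?V z \<subseteq> grid_fibre x" for z by (auto simp: grid_fibre_eq)
  show "setdist y y' \<le> real CARD('n) / 2 ^ m" if yy': "y \<in> ?V z" "y' \<in> ?V z" for z y y'
  proof -
    obtain w w' where w: "y = coset x w" "y' = coset x w'" "cell (\<lambda>_. m) w = cell (\<lambda>_. m) w'"
      using yy' by auto
    have "setdist y y' \<le> dist (w - w') 0"
      unfolding w setdist_cosets by (intro setdist_le_dist zero_lattice_points) auto
    also have "\<dots> \<le> (\<Sum>i\<in>UNIV. \<bar>(w - w') $ i\<bar>)"
      using norm_le_l1_cart[of "w - w'"] by simp
    also have "\<dots> \<le> (\<Sum>i\<in>(UNIV :: 'n set). 1 / 2 ^ m)"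
    proof (rule sum_mono)
      fix i
      have "2 ^ m * \<bar>w $ i - w' $ i\<bar> < 1"
        using abs_diff_less_if_cell_eq[of "\<lambda>_. m" w i w'] w(3) by simp
      then show "\<bar>(w - w') $ i\<bar> \<le> 1 / 2 ^ m"
        by (simp add: pos_le_divide_eq mult.commute less_imp_le)
    qed
    finally show ?thesis by simp
  qed
qed simp

text \<open>
  With \<open>m\<close> the level of the cubes after \<open>J\<close> blocks and \<open>d\<close> the dimension, the sum of the diameters
  to the power \<open>d - 2\<delta>\<close> is at most a constant times \<open>2\<^bsup>2\<delta>m\<^esup> e\<^bsup>-J/(2 2\<^sup>D)\<^esup>\<close>. As \<open>2\<^sup>m\<close> grows at most like
  \<open>e\<^bsup>4LJc\<^esup>\<close> with \<open>c\<close> the largest exponent, the bound on \<open>\<delta>\<close> lets at most half of the exponential gain be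
  lost, and the sums tend to 0 along the sequence \<open>T\<close>. One sequence suffices, since a
  Hausdorff premeasure only needs good covers at some arbitrarily small scales.
\<close>

lemma premeasure_avoiding_eq_0:
  fixes c q :: "real ^ 'n::finite" and L n0 :: nat and \<beta> \<rho> r R \<delta> :: real and T :: "nat \<Rightarrow> nat"
  assumes c: "\<And>i. \<beta> \<le> \<bar>c $ i\<bar>" and \<beta>: "\<beta> > 0" and \<rho>: "\<rho> > 0" and L0: "L > 0"
    and L: "exp (- \<beta> * L) * \<rho> < 1 / 2" "exp (- \<beta> * L) * (\<rho> + 2) < r"
    and D: "D = (\<Sum>i\<in>UNIV. level c (real (4 * L)) i + 1)"
    and i0: "\<And>i. c $ i \<le> c $ i0" "c $ i0 > 0"
    and \<delta>: "0 \<le> \<delta>" "2 * \<delta> < CARD('n)" "2 * \<delta> * (c $ i0 * (4 * L)) \<le> 1 / (4 * 2 ^ D)"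
    and T: "filterlim T at_top sequentially"
    and bad: "\<And>k. real (card {n. n < T k \<and>
        \<not> covering_radius_le ((*v) (diag_flow c (real n)) ` lattice_points x) \<rho>}) \<le> T k / 8"
    and \<epsilon>: "\<epsilon> > 0"
  shows "Metric_space.hausdorff_premeasure (grid_fibre x) setdist (real CARD('n) - 2 * \<delta>) \<epsilon>
    (coset x ` avoiding c (lattice_points x) q r R n0) = 0"
proof -
  let ?A = "avoiding c (lattice_points x) q r R n0" and ?d = "real CARD('n)"
  let ?s = "?d - 2 * \<delta>"
  let ?P = "Metric_space.hausdorff_premeasure (grid_fibre x) setdist ?s \<epsilon> (coset x ` ?A)"
  define J where "J = (\<lambda>k. T k div (4 * L))"
  define m where "m = (\<lambda>k. level c (real (J k * (4 * L))) i0)"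
  obtain C where C: "C \<ge> 0" "\<And>k. n0 \<le> J k \<Longrightarrow> finite (cell (\<lambda>_. m k) ` ?A) \<and>
      real (card (cell (\<lambda>_. m k) ` ?A)) \<le> C * 2 ^ (CARD('n) * m k) * exp (- (real (J k) / (2 * 2 ^ D)))"
  proof (rule card_cubes_avoiding[where \<Lambda> = "lattice_points x" and q = q and R = R and ?n0.0 = n0,
        OF c \<beta> \<rho> L0 L D i0(1)])
    fix C :: real
    assume C: "C \<ge> 0" and count: "\<And>J T. J = T div (4 * L) \<Longrightarrow> n0 \<le> J \<Longrightarrow>
      real (card {n. n < T \<and> \<not> covering_radius_le ((*v) (diag_flow c (real n)) ` lattice_points x) \<rho>}) \<le> T / 8 \<Longrightarrow>
      finite (cell (\<lambda>_. level c (real (J * (4 * L))) i0) ` ?A) \<and>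
      real (card (cell (\<lambda>_. level c (real (J * (4 * L))) i0) ` ?A))
        \<le> C * 2 ^ (CARD('n) * level c (real (J * (4 * L))) i0) * exp (- (real J / (2 * 2 ^ D)))"
    show thesis
      by (rule that[OF C]) (unfold m_def, rule count[OF _ _ bad], simp_all add: J_def)
  qed
  have J_top: "filterlim J at_top sequentially"
    unfolding filterlim_at_top
  proof
    fix Z :: nat
    have "eventually (\<lambda>k. Z * (4 * L) \<le> T k) sequentially"
      using T by (simp add: filterlim_at_top)
    then show "eventually (\<lambda>k. Z \<le> J k) sequentially"
    proof eventually_elim
      case (elim k)
      then have "Z * (4 * L) div (4 * L) \<le> J k" unfolding J_def by (rule div_le_mono)
      then show ?case using L0 by simp
    qed
  qed
  have Jr_top: "filterlim (\<lambda>k. real (J k)) at_top sequentially"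
    by (rule filterlim_compose[OF filterlim_real_sequentially J_top])
  define \<kappa> where "\<kappa> = c $ i0 * (4 * L)"
  have \<kappa>: "\<kappa> > 0" using i0(2) L0 by (simp add: \<kappa>_def)
  have m_le: "2 ^ m k \<le> exp (\<kappa> * J k)" and m_ge: "exp (\<kappa> * J k) \<le> 2 * 2 ^ m k" for k
    using level_bounds[of "real (J k * (4 * L))" c i0] i0(2) by (simp_all add: m_def \<kappa>_def mult_ac)
  let ?b = "\<lambda>k. C * ?d powr ?s * exp (- (1 / (4 * 2 ^ D) * real (J k)))"
  have sum_le: "real (card (cell (\<lambda>_. m k) ` ?A)) * (?d / 2 ^ m k) powr ?s \<le> ?b k" if "n0 \<le> J k" for k
  proof -
    define M where "M = (2::real) ^ m k"
    have M: "M > 0" by (simp add: M_def)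
    have Md: "2 ^ (CARD('n) * m k) = M powr ?d"
      using M by (simp add: M_def powr_realpow flip: power_mult)
    have "real (card (cell (\<lambda>_. m k) ` ?A)) * (?d / M) powr ?s
        \<le> (C * M powr ?d * exp (- (real (J k) / (2 * 2 ^ D)))) * (?d / M) powr ?s"
      using C(2)[OF that] unfolding Md by (intro mult_right_mono) auto
    also have "\<dots> = C * ?d powr ?s * exp (- (real (J k) / (2 * 2 ^ D))) * (M powr ?d / M powr ?s)"
      using M by (simp add: powr_divide)
    also have "M powr ?d / M powr ?s = M powr (2 * \<delta>)"
      by (simp flip: powr_diff)
    also have "M powr (2 * \<delta>) \<le> exp (\<kappa> * J k) powr (2 * \<delta>)"
      using m_le[of k] M \<delta>(1) by (intro powr_mono2) (auto simp: M_def)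
    also have "\<dots> = exp (2 * \<delta> * \<kappa> * J k)"
      by (simp add: exp_powr_real mult_ac)
    also have "\<dots> \<le> exp (1 / (4 * 2 ^ D) * J k)"
      using mult_right_mono[OF \<delta>(3), of "real (J k)"] by (simp add: \<kappa>_def)
    finally have "real (card (cell (\<lambda>_. m k) ` ?A)) * (?d / M) powr ?s
        \<le> C * ?d powr ?s * (exp (- (real (J k) / (2 * 2 ^ D))) * exp (1 / (4 * 2 ^ D) * J k))"
      using C(1) by (simp add: mult_left_mono mult.assoc)
    also have "exp (- (real (J k) / (2 * 2 ^ D))) * exp (1 / (4 * 2 ^ D) * J k)
        = exp (- (1 / (4 * 2 ^ D) * real (J k)))"
      by (simp add: field_simps flip: exp_add)
    finally show ?thesis by (simp add: M_def)
  qed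
  have "?b \<longlonglongrightarrow> C * ?d powr ?s * 0"
    by (intro tendsto_mult tendsto_const filterlim_compose[OF exp_at_bot] filterlim_uminus_at_bot_at_top[THEN filterlim_compose] filterlim_tendsto_pos_mult_at_top[OF tendsto_const _ Jr_top]) simp
  then have "(\<lambda>k. ennreal (?b k)) \<longlonglongrightarrow> 0"
    using tendsto_ennrealI by fastforce
  moreover have "eventually (\<lambda>k. ?P \<le> ennreal (?b k)) sequentially"
  proof -
    have "filterlim (\<lambda>k. exp (\<kappa> * real (J k))) at_top sequentially"
      by (intro filterlim_compose[OF exp_at_top] filterlim_tendsto_pos_mult_at_top[OF tendsto_const \<kappa> Jr_top])
    then have "eventually (\<lambda>k. 2 * ?d / \<epsilon> \<le> exp (\<kappa> * real (J k))) sequentially"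
      by (simp add: filterlim_at_top)
    moreover have "eventually (\<lambda>k. n0 \<le> J k) sequentially"
      using J_top by (simp add: filterlim_at_top)
    ultimately show ?thesis
    proof eventually_elim
      case (elim k)
      have "2 * ?d / \<epsilon> \<le> 2 * 2 ^ m k" using elim(1) m_ge[of k] by linarith
      then have "?d / 2 ^ m k \<le> \<epsilon>" using \<epsilon> by (simp add: field_simps)
      then have "?P \<le> ennreal (real (card (cell (\<lambda>_. m k) ` ?A)) * (?d / 2 ^ m k) powr ?s)"
        using \<delta>(2) C(2)[OF elim(2)] by (intro premeasure_cosets_le_cubes) auto
      also have "\<dots> \<le> ennreal (?b k)" by (intro ennreal_leI sum_le elim(2))
      finally show ?case .
    qed
  qed
  ultimately have "?P \<le> 0"
    by (intro tendsto_lowerbound[where F = sequentially]) auto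
  then show ?thesis by simp
qed

section \<open>Grids with finitely many points in the spike\<close>

text \<open>
  The coordinate is identically zero, tends to infinity or tends to zero; in each case it ends up far
  from a nonzero \<open>q\<close>.
\<close>

lemma eventually_orbit_coordinate_far:
  fixes a p q r :: real
  assumes a: "a \<noteq> 0" and r: "r > 0" "2 * r \<le> \<bar>q\<bar>"
  shows "\<forall>\<^sub>F n in sequentially. r \<le> \<bar>exp (a * real n) * p - q\<bar>"
proof -
  consider "p = 0" | "p \<noteq> 0" "a > 0" | "p \<noteq> 0" "a < 0" using a by linarith
  then show ?thesis
  proof cases
    case 1
    then show ?thesis using r by simp
  next
    case 2
    have "filterlim (\<lambda>n. exp (a * real n)) at_top sequentially"
      by (intro filterlim_compose[OF exp_at_top] filterlim_real_sequentially
          filterlim_tendsto_pos_mult_at_top[OF tendsto_const 2(2)])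
    then have "\<forall>\<^sub>F n in sequentially. (\<bar>q\<bar> + r) / \<bar>p\<bar> \<le> exp (a * real n)"
      by (simp add: filterlim_at_top)
    then show ?thesis
    proof eventually_elim
      case (elim n)
      then have "\<bar>q\<bar> + r \<le> \<bar>exp (a * real n) * p\<bar>"
        using 2(1) by (simp add: pos_divide_le_eq abs_mult)
      then show ?case by linarith
    qed
  next
    case 3
    have "filterlim (\<lambda>n. (- a) * real n) at_top sequentially"
      using 3 by (intro filterlim_tendsto_pos_mult_at_top[OF tendsto_const] filterlim_real_sequentially) auto
    then have "filterlim (\<lambda>n. a * real n) at_bot sequentially"
      by (simp add: filterlim_uminus_at_bot)
    then have "(\<lambda>n. exp (a * real n)) \<longlonglongrightarrow> 0"
      by (rule filterlim_compose[OF exp_at_bot])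
    then have "(\<lambda>n. \<bar>exp (a * real n) * p\<bar>) \<longlonglongrightarrow> \<bar>0 * p\<bar>"
      by (intro tendsto_intros)
    then have "\<forall>\<^sub>F n in sequentially. \<bar>exp (a * real n) * p\<bar> < r"
      using r by (intro order_tendstoD) auto
    then show ?thesis
    proof eventually_elim
      case (elim n)
      then show ?case using r by linarith
    qed
  qed
qed

text \<open>
  A point of the grid that is in the cube at a positive time belongs to the spike, hence is one of
  finitely many, and each of these is in the cube only for bounded times.
\<close>

lemma finite_grid_eventually_avoids:
  fixes c q :: "real ^ 'n::finite"
  assumes i0: "c $ i0 \<noteq> 0" "2 * r \<le> \<bar>q $ i0\<bar>" and r: "r > 0"
    and ball: "\<And>v. (\<And>i. \<bar>v $ i - q $ i\<bar> < r) \<Longrightarrow> v \<in> \<O>"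
    and fin: "finite (y \<inter> positive_spike c \<O>)"
  obtains n0 :: nat where
    "\<And>n p. n \<ge> n0 \<Longrightarrow> p \<in> y \<Longrightarrow> \<exists>i. r \<le> \<bar>exp (c $ i * real n) * p $ i - q $ i\<bar>"
proof -
  have "\<forall>\<^sub>F n in sequentially. \<forall>p \<in> y \<inter> positive_spike c \<O>. r \<le> \<bar>exp (c $ i0 * real n) * p $ i0 - q $ i0\<bar>"
    using fin i0 r by (intro eventually_ball_finite ballI eventually_orbit_coordinate_far)
  then obtain n1 where n1: "\<And>n p. n \<ge> n1 \<Longrightarrow> p \<in> y \<inter> positive_spike c \<O> \<Longrightarrow>
      r \<le> \<bar>exp (c $ i0 * real n) * p $ i0 - q $ i0\<bar>"
    by (auto simp: eventually_sequentially)
  show ?thesis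
  proof (rule that)
    fix n p assume n: "n \<ge> Suc n1" and p: "p \<in> y"
    show "\<exists>i. r \<le> \<bar>exp (c $ i * real n) * p $ i - q $ i\<bar>"
    proof (rule ccontr)
      assume *: "\<not> ?thesis"
      let ?v = "diag_flow c (real n) *v p"
      have "?v \<in> \<O>" using * by (intro ball) (simp add: diag_flow_mult not_le)
      moreover have "p = matrix_inv (diag_flow c (real n)) *v ?v"
        by (simp add: matrix_inv_diag_flow diag_flow_mult vec_eq_iff flip: mult.assoc exp_add)
      moreover have "real n > 0" using n by simp
      ultimately have "p \<in> positive_spike c \<O>"
        unfolding positive_spike_def by blast
      then show False using n1[of n p] n p * by auto
    qed
  qed
qed

lemma finite_grids_subset_avoiding:
  fixes c q :: "real ^ 'n::finite"
  assumes i0: "c $ i0 \<noteq> 0" "2 * r \<le> \<bar>q $ i0\<bar>" and r: "r > 0"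
    and ball: "\<And>v. (\<And>i. \<bar>v $ i - q $ i\<bar> < r) \<Longrightarrow> v \<in> \<O>"
    and R: "covering_radius_le (lattice_points x) R"
  shows "finite_grids (positive_spike c \<O>) x
    \<subseteq> (\<Union>n0. coset x ` avoiding c (lattice_points x) q r R n0)"
proof
  fix y assume "y \<in> finite_grids (positive_spike c \<O>) x"
  then have fin: "finite (y \<inter> positive_spike c \<O>)" and "y \<in> grid_fibre x"
    by (auto simp: finite_grids_def)
  then obtain w where w: "y = coset x w" by (auto simp: grid_fibre_eq)
  obtain l where l: "l \<in> lattice_points x" "\<And>i. \<bar>l $ i - (- w) $ i\<bar> \<le> R"
    using R unfolding covering_radius_le_def by blast
  have y: "y = coset x (w + l)" using coset_add_lattice_point[OF l(1)] w by simp
  obtain n0 :: nat where n0: "\<And>n p. n \<ge> n0 \<Longrightarrow> p \<in> y \<Longrightarrow> \<exists>i. r \<le> \<bar>exp (c $ i * real n) * p $ i - q $ i\<bar>"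
    using finite_grid_eventually_avoids[OF i0 r ball fin] by blast
  have "w + l \<in> avoiding c (lattice_points x) q r R n0"
    unfolding avoiding_def
  proof (intro CollectI conjI allI impI ballI)
    show "\<bar>(w + l) $ i\<bar> \<le> R" for i using l(2)[of i] by (simp add: add.commute)
    fix n l' assume "n0 \<le> n" "l' \<in> lattice_points x"
    then have "\<exists>i. r \<le> \<bar>exp (c $ i * real n) * (w + l + l') $ i - q $ i\<bar>"
      by (intro n0) (auto simp: y)
    then show "\<exists>i. r \<le> \<bar>exp (c $ i * real n) * ((w + l) $ i + l' $ i) - q $ i\<bar>" by simp
  qed
  then show "y \<in> (\<Union>n0. coset x ` avoiding c (lattice_points x) q r R n0)"
    using y by blast
qed

lemma open_contains_cube_off_0:
  fixes \<O> :: "(real ^ 'n::finite) set"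
  assumes "open \<O>" "\<O> \<noteq> {}"
  obtains q r i0 where "r > 0" "2 * r \<le> \<bar>q $ i0\<bar>" "\<And>v. (\<And>i. \<bar>v $ i - q $ i\<bar> < r) \<Longrightarrow> v \<in> \<O>"
proof -
  have "\<O> \<noteq> {0}" using assms(1) not_open_singleton by metis
  then obtain q where q: "q \<in> \<O>" "q \<noteq> 0" using assms(2) by blast
  then obtain i0 where i0: "q $ i0 \<noteq> 0" by (auto simp: vec_eq_iff)
  obtain e where e: "e > 0" "\<And>v. dist v q < e \<Longrightarrow> v \<in> \<O>"
    using assms(1) q(1) unfolding open_dist by blast
  define r where "r = min (\<bar>q $ i0\<bar> / 2) (e / (2 * real CARD('n)))"
  show ?thesis
  proof (rule that)
    show "r > 0" "2 * r \<le> \<bar>q $ i0\<bar>" using i0 e(1) by (auto simp: r_def)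
    fix v assume v: "\<And>i. \<bar>v $ i - q $ i\<bar> < r"
    have "dist v q \<le> (\<Sum>i\<in>UNIV. \<bar>(v - q) $ i\<bar>)"
      unfolding dist_norm by (rule norm_le_l1_cart)
    also have "\<dots> \<le> (\<Sum>i\<in>(UNIV :: 'n set). e / (2 * real CARD('n)))"
    proof (rule sum_mono)
      fix i show "\<bar>(v - q) $ i\<bar> \<le> e / (2 * real CARD('n))"
        using v[of i] by (simp add: r_def)
    qed
    also have "\<dots> < e" using e(1) by simp
    finally show "v \<in> \<O>" by (rule e(2))
  qed
qed

section \<open>The uniform dimension bound\<close>

text \<open>
  The order of the choices matters: \<open>K\<close> gives \<open>\<rho>\<close>, the set \<open>\<O>\<close> gives \<open>q\<close> and \<open>r\<close>, these determine the
  gap \<open>L\<close>, and then \<open>L\<close> determines \<open>D\<close> and \<open>\<delta>\<close>. The lattice \<open>x\<close> only enters afterwards.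
\<close>

lemma uniform_dimension_drop:
  fixes c :: "real ^ 'n::finite" and \<O> :: "(real ^ 'n) set" and K :: "'n ulattice set"
  assumes c: "\<And>i. c $ i \<noteq> 0" "(\<Sum>i\<in>UNIV. c $ i) = 0"
    and \<O>: "open \<O>" "\<O> \<noteq> {}" and K: "compact K"
  shows "\<exists>\<delta>>0. \<forall>x. \<forall>T :: nat \<Rightarrow> nat. filterlim T at_top sequentially \<longrightarrow>
      (\<forall>k. real (card {n. n < T k \<and> (act (diag_flow c 1) ^^ n) x \<notin> K}) \<le> T k / 8) \<longrightarrow>
      torus_hausdorff_dim x (finite_grids (positive_spike c \<O>) x) < ereal (real CARD('n) - \<delta>)"
proof -
  obtain q r i1 where q: "r > 0" "2 * r \<le> \<bar>q $ i1\<bar>" "\<And>v. (\<And>i. \<bar>v $ i - q $ i\<bar> < r) \<Longrightarrow> v \<in> \<O>"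
    using open_contains_cube_off_0[OF \<O>] by metis
  obtain \<rho> where \<rho>: "\<rho> > 0" "\<And>x. x \<in> K \<Longrightarrow> covering_radius_le (lattice_points x) \<rho>"
    using compact_covering_radius[OF K] by metis
  define \<beta> where "\<beta> = Min (range (\<lambda>i. \<bar>c $ i\<bar>))"
  have \<beta>: "\<beta> > 0" "\<And>i. \<beta> \<le> \<bar>c $ i\<bar>"
    using c(1) by (auto simp: \<beta>_def)
  \<comment> \<open>The largest exponent is positive, since the nonzero exponents add up to 0.\<close>
  have "Max (range (($) c)) \<in> range (($) c)" by (rule Max_in) auto
  then obtain i0 where "c $ i0 = Max (range (($) c))" by (metis imageE)
  then have i0: "c $ i \<le> c $ i0" for i by simp
  have i0_pos: "c $ i0 > 0"
  proof (rule ccontr)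
    assume "\<not> c $ i0 > 0"
    then have "c $ i < 0" for i
      using i0[of i] c(1)[of i] by linarith
    then have "(\<Sum>i\<in>UNIV. c $ i) < (\<Sum>i\<in>(UNIV :: 'n set). 0)" by (intro sum_strict_mono) auto
    then show False using c(2) by simp
  qed
  have e_lim: "(\<lambda>L::nat. exp (- \<beta> * L)) \<longlonglongrightarrow> 0"
  proof -
    have "filterlim (\<lambda>n. \<beta> * real n) at_top sequentially"
      by (intro filterlim_tendsto_pos_mult_at_top[OF tendsto_const \<beta>(1)] filterlim_real_sequentially)
    then have "filterlim (\<lambda>n. - \<beta> * real n) at_bot sequentially"
      by (simp add: filterlim_uminus_at_bot)
    then show ?thesis by (rule filterlim_compose[OF exp_at_bot])
  qed
  have "\<forall>\<^sub>F L in sequentially. exp (- \<beta> * real L) * \<rho> < 1 / 2"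
    using tendsto_mult[OF e_lim tendsto_const[of \<rho>]] by (intro order_tendstoD) auto
  moreover have "\<forall>\<^sub>F L in sequentially. exp (- \<beta> * real L) * (\<rho> + 2) < r"
    using tendsto_mult[OF e_lim tendsto_const[of "\<rho> + 2"]] q(1) by (intro order_tendstoD) auto
  moreover have "\<forall>\<^sub>F L in sequentially. L > (0::nat)" by (rule eventually_gt_at_top)
  ultimately have "\<forall>\<^sub>F L in sequentially. exp (- \<beta> * real L) * \<rho> < 1 / 2 \<and> exp (- \<beta> * real L) * (\<rho> + 2) < r \<and> L > 0"
    by eventually_elim simp
  then obtain L :: nat where L: "exp (- \<beta> * real L) * \<rho> < 1 / 2" "exp (- \<beta> * real L) * (\<rho> + 2) < r" "L > 0"
    using eventually_happens'[OF sequentially_bot] by blast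
  define D where "D = (\<Sum>i\<in>UNIV. level c (real (4 * L)) i + 1)"
  define \<kappa> where "\<kappa> = c $ i0 * (4 * real L)"
  have \<kappa>: "\<kappa> > 0" using i0_pos L(3) by (simp add: \<kappa>_def)
  \<comment> \<open>The bound 1/4 keeps \<open>2\<delta>\<close> below the dimension.\<close>
  define \<delta> where "\<delta> = min (1 / 4) (1 / (8 * 2 ^ D * \<kappa>))"
  have \<delta>: "\<delta> > 0" using \<kappa> by (simp add: \<delta>_def)
  have "2 * \<delta> * \<kappa> \<le> 2 * (1 / (8 * 2 ^ D * \<kappa>)) * \<kappa>"
    using \<kappa> by (intro mult_right_mono mult_left_mono) (auto simp: \<delta>_def)
  also have "\<dots> = 1 / (4 * 2 ^ D)" using \<kappa> by simp
  finally have \<delta>_le: "2 * \<delta> * (c $ i0 * (4 * L)) \<le> 1 / (4 * 2 ^ D)" by (simp add: \<kappa>_def)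
  have "2 * \<delta> \<le> 1 / 2" by (simp add: \<delta>_def)
  moreover have "1 \<le> real CARD('n)" by (simp add: Suc_leI)
  ultimately have \<delta>_d: "2 * \<delta> < real CARD('n)" by linarith
  show ?thesis
  proof (intro exI[of _ \<delta>] conjI \<delta> allI impI)
    fix x :: "'n ulattice" and T :: "nat \<Rightarrow> nat"
    assume T: "filterlim T at_top sequentially"
      and bad: "\<forall>k. real (card {n. n < T k \<and> (act (diag_flow c 1) ^^ n) x \<notin> K}) \<le> T k / 8"
    obtain R where R: "covering_radius_le (lattice_points x) R"
      using compact_covering_radius[OF compact_sing[of x]] by (metis singletonI)
    have bad': "real (card {n. n < T k \<and>
        \<not> covering_radius_le ((*v) (diag_flow c (real n)) ` lattice_points x) \<rho>}) \<le> T k / 8" for k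
    proof -
      have "{n. n < T k \<and> \<not> covering_radius_le ((*v) (diag_flow c (real n)) ` lattice_points x) \<rho>}
          \<subseteq> {n. n < T k \<and> (act (diag_flow c 1) ^^ n) x \<notin> K}"
        using \<rho>(2) by (auto simp flip: lattice_points_act_diag_flow[OF c(2)])
      then have "card {n. n < T k \<and> \<not> covering_radius_le ((*v) (diag_flow c (real n)) ` lattice_points x) \<rho>}
          \<le> card {n. n < T k \<and> (act (diag_flow c 1) ^^ n) x \<notin> K}"
        by (intro card_mono) auto
      then show ?thesis using bad[rule_format, of k] by linarith
    qed
    have "torus_hausdorff_dim x (finite_grids (positive_spike c \<O>) x) \<le> ereal (real CARD('n) - 2 * \<delta>)"
      unfolding torus_hausdorff_dim_def
    proof (rule Metric_space.hausdorff_dim_UN_le[OF Metric_space_grid_fibre])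
      show "0 < real CARD('n) - 2 * \<delta>" using \<delta>_d by simp
      show "finite_grids (positive_spike c \<O>) x
          \<subseteq> (\<Union>n0. coset x ` avoiding c (lattice_points x) q r R n0)"
        by (rule finite_grids_subset_avoiding[where ?i0.0 = i1, OF c(1) q(2,1) q(3) R])
      show "Metric_space.hausdorff_premeasure (grid_fibre x) setdist (real CARD('n) - 2 * \<delta>) \<epsilon>
          (coset x ` avoiding c (lattice_points x) q r R n0) = 0" if "\<epsilon> > 0" for n0 \<epsilon>
        using \<delta> by (intro premeasure_avoiding_eq_0[where T = T, OF \<beta>(2,1) \<rho>(1) L(3,1,2) D_def i0 i0_pos _ \<delta>_d \<delta>_le T bad' that]) simp
    qed
    also have "\<dots> < ereal (real CARD('n) - \<delta>)" using \<delta> by simp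
    finally show "torus_hausdorff_dim x (finite_grids (positive_spike c \<O>) x) < ereal (real CARD('n) - \<delta>)" .
  qed
qed

theorem theorem1p3:
  fixes c :: "real ^ 'n"
    and \<psi> :: "nat \<Rightarrow> 'n::finite ulattice \<Rightarrow> real"
    and \<O> :: "(real ^ 'n) set"
  assumes "CARD('n) \<ge> 2"
    and "\<forall>j. c $ j \<noteq> 0"
    and "(\<Sum>j\<in>UNIV. c $ j) = 0"
    and "\<forall>i. \<psi> i \<in> Cc_functions"
    and "\<forall>i z. 0 \<le> \<psi> i z \<and> \<psi> i z \<le> 1"
    and "\<forall>i. compact (\<psi> i -` {1})"
    and "incseq (\<lambda>i. \<psi> i -` {1})"
    and "(\<Union>i. \<psi> i -` {1}) = UNIV"
    and "open \<O>" and "bounded \<O>" and "\<O> \<noteq> {}"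
  shows "(\<forall>x. heavy c x \<longrightarrow>
      torus_hausdorff_dim x (finite_grids (positive_spike c \<O>) x) < ereal (real CARD('n)))
    \<and> (\<forall>\<eta> :: nat \<Rightarrow> real. (\<forall>i. 0 \<le> \<eta> i) \<and> \<eta> \<longlonglongrightarrow> 0 \<longrightarrow>
      (\<exists>\<delta>>0. \<forall>x\<in>heavy_lattices c \<psi> \<eta>.
        torus_hausdorff_dim x (finite_grids (positive_spike c \<O>) x)
          < ereal (real CARD('n) - \<delta>)))"
proof -
  have uniform: "\<exists>\<delta>>0. \<forall>x\<in>heavy_lattices c \<psi> \<eta>.
      torus_hausdorff_dim x (finite_grids (positive_spike c \<O>) x) < ereal (real CARD('n) - \<delta>)"
    if \<eta>: "\<eta> \<longlonglongrightarrow> 0" for \<eta> :: "nat \<Rightarrow> real"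
  proof -
    have "\<forall>\<^sub>F i in sequentially. \<eta> i < 1 / 8" using \<eta> by (rule order_tendstoD) simp
    then obtain i where i: "\<eta> i < 1 / 8"
      using eventually_happens'[OF sequentially_bot] by blast
    let ?K = "closure {z. \<psi> i z \<noteq> 0}"
    have "compact ?K" using assms(4) by (simp add: Cc_functions_def)
    from uniform_dimension_drop[OF assms(2)[rule_format] assms(3,9,11) this]
    obtain \<delta> where \<delta>: "\<delta> > 0"
      "\<forall>x. \<forall>T :: nat \<Rightarrow> nat. filterlim T at_top sequentially \<longrightarrow>
        (\<forall>k. real (card {n. n < T k \<and> (act (diag_flow c 1) ^^ n) x \<notin> ?K}) \<le> T k / 8) \<longrightarrow>
        torus_hausdorff_dim x (finite_grids (positive_spike c \<O>) x) < ereal (real CARD('n) - \<delta>)"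
      by blast
    have "torus_hausdorff_dim x (finite_grids (positive_spike c \<O>) x) < ereal (real CARD('n) - \<delta>)"
      if x: "x \<in> heavy_lattices c \<psi> \<eta>" for x
    proof -
      obtain \<mu> where \<mu>: "\<mu> \<in> accumulation_measures c x" "(\<integral>z. \<psi> i z \<partial>\<mu>) \<ge> 1 - \<eta> i"
        using x unfolding heavy_lattices_def tight_prob_measures_def by blast
      have mass: "(\<integral>z. \<psi> i z \<partial>\<mu>) > 1 - 1 / 8" using \<mu>(2) i by linarith
      have le_1: "\<psi> i z \<le> 1" for z using assms(5) by blast
      from frequent_visits[OF \<mu>(1) assms(4)[rule_format] le_1 mass]
      obtain T :: "nat \<Rightarrow> nat" where T: "filterlim T at_top sequentially"
        "\<forall>k. real (card {n. n < T k \<and> (act (diag_flow c 1) ^^ n) x \<notin> ?K}) \<le> 1 / 8 * T k"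
        by blast
      then show ?thesis using \<delta>(2)[rule_format, OF T(1)] by simp
    qed
    then show ?thesis using \<delta>(1) by blast
  qed
  have "torus_hausdorff_dim x (finite_grids (positive_spike c \<O>) x) < ereal (real CARD('n))"
    if heavy: "heavy c x" for x
  proof -
    obtain \<mu> where \<mu>: "\<mu> \<in> accumulation_measures c x" "\<mu> \<in> borel_prob_measures"
      using heavy unfolding heavy_def by blast
    define \<eta> where "\<eta> = (\<lambda>i. 1 - (\<integral>z. \<psi> i z \<partial>\<mu>))"
    have "(\<lambda>i. \<integral>z. \<psi> i z \<partial>\<mu>) \<longlonglongrightarrow> 1"
      using assms(4,5) by (intro integral_exhaustion_tendsto_1 \<mu>(2) assms(7,8)) (auto simp: Cc_functions_def)
    then have "\<eta> \<longlonglongrightarrow> 1 - 1" unfolding \<eta>_def by (intro tendsto_intros)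
    then obtain \<delta> where "\<delta> > 0" "\<forall>x\<in>heavy_lattices c \<psi> \<eta>.
        torus_hausdorff_dim x (finite_grids (positive_spike c \<O>) x) < ereal (real CARD('n) - \<delta>)"
      using uniform[of \<eta>] by auto
    moreover have "x \<in> heavy_lattices c \<psi> \<eta>"
      using \<mu> unfolding heavy_lattices_def tight_prob_measures_def by (auto simp: \<eta>_def)
    moreover have "ereal (real CARD('n) - \<delta>) < ereal (real CARD('n))" using \<open>\<delta> > 0\<close> by simp
    ultimately show ?thesis by (meson less_trans)
  qed
  then show ?thesis using uniform by blast
qed

end
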